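(* Let $A\in\mathbb{R}^{2p\times 2p}$ be a normal matrix with eigenvalues $\lambda_je^{\pm i\theta_j}$, where $\lambda_j>0$ and $\theta_j\in(0,\pi)$ for $j=1,\dots,p$, with real Schur decomposition $A=QSQ^\top$, and let $\Omega:=\frac12(A-A^\top)$. Write $c_j:=\cos(\theta_j)$ and $s_j:=\sin(\theta_j)$. Assume there is a subset $[j]\subseteq\{1,\dots,p\}$ such that $\lambda_js_j=\sigma$ for all $j\in[j]$. Set $[i]:=\{1,\dots,p\}\setminus[j]$, $m:=|[j]|$, and let $D_m$ be an $m\times m$ diagonal matrix containing the real parts $\lambda_jc_j$ for all $j\in[j]$. If the matrix $V\in\mathrm{St}(2p,2m)$ satisfies $$\Omega V-V\sigma\begin{bmatrix}0&-I_m\\ I_m&0\end{bmatrix}=E\quad\text{with}\quad \|E\|_{\mathrm F}\le\tau\varepsilon_{\mathrm m}\|A\|_{\mathrm F},$$ then $$\min_{R\in\mathrm{OSp}(2m)}\left\|A(VR)-(VR)\begin{bmatrix}D_m&-\sigma I_m\\ \sigma I_m&D_m\end{bmatrix}\right\|_{\mathrm F}\le\tau\varepsilon_{\mathrm m}\|A\|_{\mathrm F}\left(1+\frac{\max\limits_{i\in[i],\,j\in[j]}|\lambda_ic_i-\lambda_jc_j|}{\min\limits_{i\in[i]}|\lambda_is_i-\sigma|}+\frac{\max\limits_{j_1,j_2\in[j]}|\lambda_{j_1}c_{j_1}-\lambda_{j_2}c_{j_2}|}{\sigma}\right)+\mathrm{o}(\varepsilon_{\mathrm m}).$$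
   Context: $\mathrm{St}(n,k)=\{V\in\mathbb{R}^{n\times k}: V^\top V=I_k\}$. The set of ortho-symplectic matrices is $$\mathrm{OSp}(2m)=\left\{\begin{bmatrix}U_{\mathrm r}&-U_{\mathrm i}\\ U_{\mathrm i}&U_{\mathrm r}\end{bmatrix}\in\mathrm{O}(2m)\ :\ U_{\mathrm r},U_{\mathrm i}\in\mathbb{R}^{m\times m}\right\},$$ where $\mathrm{O}(2m)$ is the orthogonal group. A real Schur decomposition (RSD) of a normal matrix $A\in\mathbb{R}^{2p\times 2p}$ with non-real eigenvalues $\lambda_je^{\pm i\theta_j}$, $\lambda_j>0$, $\theta_j\in(0,\pi)$, $j=1,\dots,p$, is $A=QSQ^\top$ with $Q\in\mathrm{O}(2p)$ and $S$ block diagonal with the $2\times2$ diagonal blocks $\lambda_j\begin{bmatrix}\cos\theta_j&-\sin\theta_j\\ \sin\theta_j&\cos\theta_j\end{bmatrix}$, $j=1,\dots,p$. $\|\cdot\|_{\mathrm F}$ is the Frobenius norm. All operations are in exact arithmetic. $\varepsilon_{\mathrm m}>0$ is a small parameter (the unit roundoff) and $\tau\ge1$ is a constant. The term $\mathrm{o}(\varepsilon_{\mathrm m})$ refers to the limit $\varepsilon_{\mathrm m}\to0$ with $A$, $[j]$ and $\tau$ fixed: it denotes a quantity bounded by a function $g(\varepsilon_{\mathrm m})$, depending only on these fixed data, with $g(\varepsilon_{\mathrm m})/\varepsilon_{\mathrm m}\to0$. The set $[j]$ is nonempty; the bound is meaningful when $\lambda_is_i\ne\sigma$ for all $i\in[i]$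 (which is understood), and if $[i]$ is empty the first fraction is read as $0$. *)

theory Defs
  imports
    "HOL-Library.Landau_Symbols"
    "Jordan_Normal_Form.Char_Poly"
begin

definition frobenius_norm :: "real mat \<Rightarrow> real" where
  "frobenius_norm A = sqrt (\<Sum>i<dim_row A. \<Sum>j<dim_col A. (A $$ (i, j))\<^sup>2)"

definition normal_real_mat :: "real mat \<Rightarrow> bool" where
  "normal_real_mat A \<longleftrightarrow> A * transpose_mat A = transpose_mat A * A"

definition stiefel :: "nat \<Rightarrow> nat \<Rightarrow> real mat set" where
  "stiefel n k = {V \<in> carrier_mat n k. transpose_mat V * V = 1\<^sub>m k}"

text \<open>The predicate \<^const>\<open>orthogonal_mat\<close> only asks for orthogonal columns that are not
  necessarily normalised, so it does not describe the orthogonal group.\<close>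

definition orthogonal_group :: "nat \<Rightarrow> real mat set" where
  "orthogonal_group n =
    {Q \<in> carrier_mat n n. transpose_mat Q * Q = 1\<^sub>m n \<and> Q * transpose_mat Q = 1\<^sub>m n}"

text \<open>The argument is half the dimension: \<open>ortho_symplectic m\<close> is OSp(2m).\<close>

definition ortho_symplectic :: "nat \<Rightarrow> real mat set" where
  "ortho_symplectic m =
    {four_block_mat Ur (- Ui) Ui Ur | Ur Ui.
       Ur \<in> carrier_mat m m \<and> Ui \<in> carrier_mat m m \<and>
       four_block_mat Ur (- Ui) Ui Ur \<in> orthogonal_group (2 * m)}"

definition schur_block :: "real \<Rightarrow> real \<Rightarrow> real mat" where
  "schur_block l t = l \<cdot>\<^sub>m mat_of_rows_list 2 [[cos t, - sin t], [sin t, cos t]]"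

text \<open>The eigenvalue data are indexed by \<open>{1..p}\<close>; values outside this range play no role.\<close>

definition real_schur_decomposition ::
  "nat \<Rightarrow> real mat \<Rightarrow> (nat \<Rightarrow> real) \<Rightarrow> (nat \<Rightarrow> real) \<Rightarrow> real mat \<Rightarrow> real mat \<Rightarrow> bool" where
  "real_schur_decomposition p A l t Q S \<longleftrightarrow>
     Q \<in> orthogonal_group (2 * p) \<and>
     S = diag_block_mat (map (\<lambda>j. schur_block (l j) (t j)) [1..<p + 1]) \<and>
     A = Q * S * transpose_mat Q"

definition skew_part :: "real mat \<Rightarrow> real mat" where
  "skew_part A = (1 / 2) \<cdot>\<^sub>m (A - transpose_mat A)"

end

theory Submission
  imports Defs "HOL-Analysis.Function_Topology" "HOL-Combinatorics.List_Permutation"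
begin

text \<open>In the coordinates of the real Schur decomposition, \<open>W = Q\<^sup>T V R\<close> consists of \<open>2 \<times> 2\<close> blocks, each
pairing the two rows of one Schur block with the columns \<open>k\<close> and \<open>k + m\<close>.  Read as a real-linear map
on the complex plane, such a block is \<open>z \<mapsto> P z + N cnj z\<close>.  The complex coordinates are
chosen so that a Schur block is multiplication by \<open>h\<^sub>j + \<i> w\<^sub>j\<close>, where \<open>h\<^sub>j = l\<^sub>j cos t\<^sub>j\<close> and
\<open>w\<^sub>j = l\<^sub>j sin t\<^sub>j\<close>, the matrix \<open>[[D, - \<sigma>], [\<sigma>, D]]\<close> is multiplication by \<open>d\<^sub>k + \<i> \<sigma>\<close>, and OSp(2m)
is the unitary group U(m).  Linear and antilinear parts are orthogonal, hence
(lemma \<open>sylvester_norm\<close>)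

  \<open>\<parallel>E\<parallel>\<^sup>2 = 2 \<Sum>\<^sub>j\<^sub>k (w\<^sub>j - \<sigma>)\<^sup>2 |P\<^sub>j\<^sub>k|\<^sup>2 + (w\<^sub>j + \<sigma>)\<^sup>2 |N\<^sub>j\<^sub>k|\<^sup>2\<close>,

and the squared norm of the residual is the same sum with \<open>(h\<^sub>j - d\<^sub>k)\<^sup>2\<close> added to both weights.  For \<open>j\<close>
outside \<open>J\<close> the ratio of the weights is at most \<open>1 + (\<alpha>/\<delta>)\<^sup>2\<close>, where \<open>\<alpha>\<close> and \<open>\<delta>\<close> are the maximum and
the minimum in the first fraction.  For \<open>j\<close> in \<open>J\<close> the antilinear part has
ratio at most \<open>1 + (\<beta>/\<sigma>)\<^sup>2\<close>, where \<open>\<beta>\<close> is the maximum in the second fraction.  These give the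
first-order bound.\<close>

text \<open>The linear part over \<open>J\<close> is a square complex matrix \<open>M\<close>.  It is not controlled by \<open>E\<close>, and this is
where \<open>R\<close> enters.  The orthonormal columns of \<open>W\<close> give \<open>P\<^sup>* P + N\<^sup>T cnj N = 1\<close>
(lemma \<open>stiefel_parts_gram\<close>), so \<open>M\<^sup>* M\<close> differs from the identity by a quantity quadratic in \<open>\<parallel>E\<parallel>\<close>.
Taking for \<open>R\<close> a maximiser of \<open>Re tr M\<close> over the compact group OSp(2m) makes \<open>M\<close> Hermitian and positive
semidefinite (lemmas \<open>maximal_trace_quadratic_form\<close> and \<open>real_quadratic_form_hermitian\<close>): this is a
polar decomposition, obtained without singular values.  Then \<open>\<parallel>1 - M\<parallel> \<le> \<parallel>1 - M\<^sup>2\<parallel>\<close>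
(lemma \<open>psd_distance_to_one\<close>), and as the identity matrix contributes nothing to the residual because
\<open>d\<^sub>k = h\<^sub>k\<close> after matching indices, \<open>M\<close> contributes to it only at second order.
This holds for every \<open>\<epsilon> > 0\<close>, with \<open>g\<close> a multiple of \<open>\<epsilon>\<^sup>2\<close>, and the minimising \<open>R\<close> can only do better.\<close>

section \<open>A polar decomposition from trace maximisation\<close>

text \<open>The variation behind the polar decomposition: if no unitary \<open>G\<close> increases \<open>Re tr (M G)\<close> beyond its value
at the identity, then comparing with the rotations \<open>G = 1 - c v v\<^sup>*\<close> in the single direction \<open>v\<close> forces the
quadratic form of \<open>M\<close> to be real and nonnegative at \<open>v\<close>.\<close>

lemma maximal_trace_quadratic_form:
  fixes M :: "nat \<Rightarrow> nat \<Rightarrow> complex" and v :: "nat \<Rightarrow> complex"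
  assumes maximal: "\<And>G. (\<And>a b. a < m \<Longrightarrow> b < m \<Longrightarrow>
        (\<Sum>k<m. cnj (G k a) * G k b) = (if a = b then 1 else 0)) \<Longrightarrow>
      Re (\<Sum>a<m. \<Sum>b<m. M a b * G b a) \<le> Re (\<Sum>a<m. M a a)"
  defines "z \<equiv> \<Sum>a<m. \<Sum>b<m. cnj (v a) * M a b * v b"
  shows "Im z = 0 \<and> 0 \<le> Re z"
proof (cases "\<forall>a<m. v a = 0")
  case True
  then show ?thesis by (simp add: z_def)
next
  case False
  define s where "s = (\<Sum>a<m. (cmod (v a))\<^sup>2)"
  have s_pos: "s > 0"
  proof -
    from False obtain a where a: "a < m" "v a \<noteq> 0" by auto
    have "0 < (cmod (v a))\<^sup>2" using a by simp
    also have "\<dots> \<le> s"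
      unfolding s_def by (rule member_le_sum) (use a in auto)
    finally show ?thesis .
  qed
  have s_eq: "(\<Sum>k<m. cnj (v k) * v k) = of_real s"
    unfolding s_def of_real_sum
    by (rule sum.cong) (auto simp: complex_norm_square mult.commute simp del: of_real_power)
  have quadratic: "0 \<le> x\<^sup>2 * Re z + x * Im z" for x :: real
  proof -
    \<comment> \<open>\<open>c = 2 x / ((x + \<i>) s)\<close>: a rational parametrisation of the circle \<open>c + cnj c = |c|\<^sup>2 s\<close>, the condition for
      \<open>1 - c v v\<^sup>*\<close> to be unitary\<close>
    define w where "w = (1 + x\<^sup>2) * s"
    define c where "c = Complex (2 * x\<^sup>2 / w) (- 2 * x / w)"
    define G where "G = (\<lambda>a b. (if a = b then 1 else 0) - c * v a * cnj (v b))"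
    have w_pos: "w > 0" using s_pos by (simp add: w_def add_pos_nonneg)
    have c_eq: "c + cnj c = c * cnj c * of_real s"
    proof (rule complex_eqI)
      have "((2 * x\<^sup>2 / w)\<^sup>2 + (2 * x / w)\<^sup>2) * s = 4 * x\<^sup>2 * w / w\<^sup>2"
        by (simp add: power_divide add_divide_distrib[symmetric])
          (simp add: w_def power2_eq_square power4_eq_xxxx algebra_simps)
      also have "\<dots> = 2 * (2 * x\<^sup>2 / w)"
        using w_pos by (simp add: power2_eq_square)
      finally show "Re (c + cnj c) = Re (c * cnj c * of_real s)"
        by (simp add: c_def power2_eq_square)
      show "Im (c + cnj c) = Im (c * cnj c * of_real s)"
        by (simp add: c_def)
    qed
    have "(\<Sum>k<m. cnj (G k a) * G k b) = (if a = b then 1 else 0)" if "a < m" "b < m" for a b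
    proof -
      have "(\<Sum>k<m. cnj (G k a) * G k b) =
        (\<Sum>k<m. (if k = a then (if a = b then 1 else 0) - c * v a * cnj (v b) else 0)
          - (if k = b then cnj c * v a * cnj (v b) else 0)
          + c * cnj c * v a * cnj (v b) * (cnj (v k) * v k))"
        by (rule sum.cong) (auto simp: G_def algebra_simps)
      also have "\<dots> = (if a = b then 1 else 0) - c * v a * cnj (v b) - cnj c * v a * cnj (v b)
          + c * cnj c * v a * cnj (v b) * of_real s"
        using that by (simp add: sum.distrib sum_subtractf sum_distrib_left[symmetric] s_eq)
      also have "\<dots> = (if a = b then 1 else 0)
          + v a * cnj (v b) * (c * cnj c * of_real s - (c + cnj c))"
        by (simp add: algebra_simps)
      finally show ?thesis by (simp add: c_eq)
    qed
    then have "Re (\<Sum>a<m. \<Sum>b<m. M a b * G b a) \<le> Re (\<Sum>a<m. M a a)"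
      by (rule maximal)
    moreover have "(\<Sum>a<m. \<Sum>b<m. M a b * G b a) = (\<Sum>a<m. M a a) - c * z"
    proof -
      have "(\<Sum>b<m. M a b * G b a) = M a a - c * (\<Sum>b<m. cnj (v a) * M a b * v b)" if "a < m" for a
      proof -
        have "(\<Sum>b<m. M a b * G b a)
          = (\<Sum>b<m. (if b = a then M a a else 0) - c * (cnj (v a) * M a b * v b))"
          by (rule sum.cong) (auto simp: G_def algebra_simps)
        also have "\<dots> = M a a - c * (\<Sum>b<m. cnj (v a) * M a b * v b)"
          using that by (simp add: sum_subtractf sum_distrib_left)
        finally show ?thesis .
      qed
      then show ?thesis
        by (simp add: sum_subtractf z_def sum_distrib_left)
    qed
    ultimately have "0 \<le> Re (c * z)" by simp
    also have "Re (c * z) = 2 / w * (x\<^sup>2 * Re z + x * Im z)"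
      by (simp add: c_def algebra_simps)
    finally show ?thesis
      using w_pos by (simp add: zero_le_divide_iff)
  qed
  have nonneg: "0 \<le> Re z" using quadratic[of 1] quadratic[of "-1"] by simp
  \<comment> \<open>the linear term dominates near \<open>x = 0\<close>; this \<open>x\<close> turns the quadratic polynomial into minus a square\<close>
  define x where "x = - Im z / (Re z + 1)"
  have "x\<^sup>2 * Re z + x * Im z = - (Im z / (Re z + 1))\<^sup>2"
    using nonneg by (simp add: x_def divide_simps) (simp add: power2_eq_square algebra_simps)
  with quadratic[of x] have "(Im z / (Re z + 1))\<^sup>2 \<le> 0" by linarith
  then have "Im z = 0" using nonneg by (simp add: add_nonneg_eq_0_iff)
  with nonneg show ?thesis by simp
qed

text \<open>Polarisation, tested on the vectors \<open>e\<^sub>a\<close>, \<open>e\<^sub>b\<close>, \<open>e\<^sub>a + e\<^sub>b\<close> and \<open>e\<^sub>a + \<i> e\<^sub>b\<close>.\<close>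

lemma real_quadratic_form_hermitian:
  fixes M :: "nat \<Rightarrow> nat \<Rightarrow> complex"
  assumes real: "\<And>v. Im (\<Sum>a<m. \<Sum>b<m. cnj (v a) * M a b * v b) = 0"
    and "a < m" "b < m"
  shows "M a b = cnj (M b a)"
proof -
  define q where "q = (\<lambda>x y. \<Sum>i<m. \<Sum>j<m.
    cnj ((if i = a then x else 0) + (if i = b then y else 0)) * M i j *
    ((if j = a then x else 0) + (if j = b then y else 0)))"
  have q_eq: "q x y = cnj x * M a a * x + cnj x * M a b * y + cnj y * M b a * x + cnj y * M b b * y"
    for x y
  proof -
    have "q x y = (\<Sum>i<m. \<Sum>j<m.
        (if j = a then (if i = a then cnj x * M a a * x else 0) else 0)
      + (if j = b then (if i = a then cnj x * M a b * y else 0) else 0)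
      + (if j = a then (if i = b then cnj y * M b a * x else 0) else 0)
      + (if j = b then (if i = b then cnj y * M b b * y else 0) else 0))"
      unfolding q_def by (intro sum.cong refl) (auto simp: algebra_simps)
    also have "\<dots> = cnj x * M a a * x + cnj x * M a b * y + cnj y * M b a * x + cnj y * M b b * y"
      using assms(2,3) by (simp add: sum.distrib)
    finally show ?thesis .
  qed
  have q_real: "Im (q x y) = 0" for x y
    unfolding q_def by (rule real)
  have diag: "Im (M a a) = 0" "Im (M b b) = 0"
    using q_real[of 1 0] q_real[of 0 1] by (simp_all add: q_eq)
  have "Im (M a b) + Im (M b a) = 0"
    using q_real[of 1 1] diag by (simp add: q_eq)
  moreover have "Re (M a b) - Re (M b a) = 0"
    using q_real[of 1 \<i>] diag by (simp add: q_eq)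
  ultimately show ?thesis by (intro complex_eqI) auto
qed

text \<open>With \<open>X = 1 - M\<close>, the defect \<open>1 - M\<^sup>* M = 1 - M\<^sup>2\<close> equals \<open>X + M X\<close>, and the cross term in its Frobenius norm is
twice the sum of the quadratic form of \<open>M\<close> over the columns of \<open>X\<close>.\<close>

lemma psd_distance_to_one:
  fixes M :: "nat \<Rightarrow> nat \<Rightarrow> complex"
  assumes hermitian: "\<And>a b. a < m \<Longrightarrow> b < m \<Longrightarrow> M a b = cnj (M b a)"
    and psd: "\<And>v. 0 \<le> Re (\<Sum>a<m. \<Sum>b<m. cnj (v a) * M a b * v b)"
  shows "(\<Sum>a<m. \<Sum>b<m. (cmod ((if a = b then 1 else 0) - M a b))\<^sup>2)
    \<le> (\<Sum>a<m. \<Sum>b<m. (cmod ((if a = b then 1 else 0) - (\<Sum>k<m. cnj (M k a) * M k b)))\<^sup>2)"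
proof -
  define X where "X = (\<lambda>a b. (if a = b then 1 else 0) - M a b)"
  define Y where "Y = (\<lambda>a b. \<Sum>k<m. M a k * X k b)"
  have sq: "(if a = b then 1 else 0) - (\<Sum>k<m. cnj (M k a) * M k b) = X a b + Y a b"
    if "a < m" "b < m" for a b
  proof -
    have "(\<Sum>k<m. cnj (M k a) * M k b) = (\<Sum>k<m. M a k * M k b)"
      by (rule sum.cong) (simp_all add: hermitian[OF that(1)])
    moreover have "Y a b = (\<Sum>k<m. (if k = b then M a b else 0) - M a k * M k b)"
      unfolding Y_def X_def by (rule sum.cong) (auto simp: algebra_simps)
    ultimately show ?thesis using that by (simp add: X_def sum_subtractf)
  qed
  have expand: "(cmod (x + y))\<^sup>2 = (cmod x)\<^sup>2 + 2 * Re (cnj x * y) + (cmod y)\<^sup>2" for x y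
    unfolding cmod_power2 by (simp add: power2_eq_square algebra_simps)
  have "(\<Sum>a<m. \<Sum>b<m. (cmod (X a b))\<^sup>2)
      \<le> (\<Sum>a<m. \<Sum>b<m. (cmod (X a b))\<^sup>2) + 2 * (\<Sum>b<m. Re (\<Sum>a<m. \<Sum>k<m. cnj (X a b) * M a k * X k b))"
    using psd by (simp add: sum_nonneg)
  also have "(\<Sum>b<m. Re (\<Sum>a<m. \<Sum>k<m. cnj (X a b) * M a k * X k b))
      = (\<Sum>a<m. \<Sum>b<m. Re (cnj (X a b) * Y a b))"
    unfolding Y_def Re_sum sum_distrib_left
    by (subst sum.swap) (simp only: mult.assoc)
  also have "(\<Sum>a<m. \<Sum>b<m. (cmod (X a b))\<^sup>2) + 2 * (\<Sum>a<m. \<Sum>b<m. Re (cnj (X a b) * Y a b))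
      \<le> (\<Sum>a<m. \<Sum>b<m. (cmod (X a b + Y a b))\<^sup>2)"
    unfolding expand sum_distrib_left sum.distrib[symmetric]
    by (intro sum_mono) simp
  also have "\<dots> = (\<Sum>a<m. \<Sum>b<m. (cmod ((if a = b then 1 else 0) - (\<Sum>k<m. cnj (M k a) * M k b)))\<^sup>2)"
    by (intro sum.cong refl) (simp add: sq)
  finally show ?thesis by (simp add: X_def)
qed

section \<open>Indexing and the Frobenius norm\<close>

lemma sum_consecutive_pairs:
  fixes f :: "nat \<Rightarrow> 'a::comm_monoid_add"
  shows "(\<Sum>r<2 * p. f r) = (\<Sum>j\<in>{1..p}. f (2 * j - 2) + f (2 * j - 1))"
  by (induction p) (auto simp: add.assoc)

lemma sum_two_halves:
  fixes f :: "nat \<Rightarrow> 'a::comm_monoid_add"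
  shows "(\<Sum>k<2 * m. f k) = (\<Sum>k<m. f k + f (k + m))"
proof -
  have "(\<Sum>k<m + n. f k) = (\<Sum>k<m. f k) + (\<Sum>k<n. f (k + m))" for n
    by (induction n) (auto simp: ac_simps)
  from this[of m] show ?thesis by (simp add: sum.distrib mult_2)
qed

lemma index_two_halves: "k < 2 * m \<Longrightarrow> k < m \<or> (\<exists>k'<m. k = k' + m)" for k m :: nat
  by (cases "k < m") (auto intro!: exI[of _ "k - m"])

lemma mult_mat_entry:
  "A \<in> carrier_mat n k \<Longrightarrow> B \<in> carrier_mat k q \<Longrightarrow> i < n \<Longrightarrow> j < q \<Longrightarrow>
    (A * B) $$ (i, j) = (\<Sum>r<k. A $$ (i, r) * B $$ (r, j))"
  by (auto simp: scalar_prod_def atLeast0LessThan)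

lemma frobenius_norm_sq:
  "X \<in> carrier_mat n k \<Longrightarrow> (frobenius_norm X)\<^sup>2 = (\<Sum>i<n. \<Sum>j<k. (X $$ (i, j))\<^sup>2)"
  by (auto simp: frobenius_norm_def sum_nonneg)

lemma frobenius_norm_nonneg: "0 \<le> frobenius_norm X"
  by (simp add: frobenius_norm_def sum_nonneg)

lemma frobenius_norm_transpose:
  assumes "X \<in> carrier_mat n k"
  shows "frobenius_norm (transpose_mat X) = frobenius_norm X"
proof -
  have "(\<Sum>i<k. \<Sum>j<n. (transpose_mat X $$ (i, j))\<^sup>2) = (\<Sum>i<k. \<Sum>j<n. (X $$ (j, i))\<^sup>2)"
    using assms by (intro sum.cong refl) auto
  also have "\<dots> = (\<Sum>j<n. \<Sum>i<k. (X $$ (j, i))\<^sup>2)" by (rule sum.swap)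
  finally show ?thesis using assms by (simp add: frobenius_norm_def)
qed

lemma frobenius_norm_mult_left:
  assumes X: "X \<in> carrier_mat n k" and Q: "Q \<in> carrier_mat n n" "transpose_mat Q * Q = 1\<^sub>m n"
  shows "frobenius_norm (Q * X) = frobenius_norm X"
proof -
  have trace: "(frobenius_norm Y)\<^sup>2 = (\<Sum>j<k. (transpose_mat Y * Y) $$ (j, j))"
    if Y: "Y \<in> carrier_mat n k" for Y
  proof -
    have "(\<Sum>j<k. (transpose_mat Y * Y) $$ (j, j)) = (\<Sum>j<k. \<Sum>i<n. (Y $$ (i, j))\<^sup>2)"
      using Y by (intro sum.cong refl)
        (simp add: mult_mat_entry[of _ k n _ k] power2_eq_square del: index_mult_mat)
    also have "\<dots> = (frobenius_norm Y)\<^sup>2"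
      unfolding frobenius_norm_sq[OF Y] by (rule sum.swap)
    finally show ?thesis by simp
  qed
  have "transpose_mat (Q * X) * (Q * X) = transpose_mat X * ((transpose_mat Q * Q) * X)"
    using X Q(1) by (simp add: transpose_mult[of Q n n X k] assoc_mult_mat[of _ k n _ n _ k]
      assoc_mult_mat[of _ n n _ n _ k])
  also have "\<dots> = transpose_mat X * X" using X Q by simp
  finally have "(frobenius_norm (Q * X))\<^sup>2 = (frobenius_norm X)\<^sup>2"
    using X Q(1) by (simp add: trace)
  then show ?thesis by (simp add: frobenius_norm_nonneg)
qed

lemma frobenius_norm_mult_right:
  assumes X: "X \<in> carrier_mat n k" and R: "R \<in> carrier_mat k k" "R * transpose_mat R = 1\<^sub>m k"
  shows "frobenius_norm (X * R) = frobenius_norm X"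
proof -
  have "frobenius_norm (X * R) = frobenius_norm (transpose_mat R * transpose_mat X)"
    using X R(1) by (metis frobenius_norm_transpose mult_carrier_mat transpose_mult)
  also have "\<dots> = frobenius_norm (transpose_mat X)"
    by (rule frobenius_norm_mult_left[of _ k n]) (use X R in auto)
  finally show ?thesis using frobenius_norm_transpose[OF X] by simp
qed

section \<open>The ortho-symplectic group\<close>

lemma ortho_symplectic_iff:
  "R \<in> ortho_symplectic m \<longleftrightarrow> R \<in> orthogonal_group (2 * m) \<and>
    (\<forall>a<m. \<forall>b<m. R $$ (a + m, b + m) = R $$ (a, b) \<and> R $$ (a, b + m) = - R $$ (a + m, b))"
proof
  assume "R \<in> ortho_symplectic m"
  then show "R \<in> orthogonal_group (2 * m) \<and>
    (\<forall>a<m. \<forall>b<m. R $$ (a + m, b + m) = R $$ (a, b) \<and> R $$ (a, b + m) = - R $$ (a + m, b))"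
    by (auto simp: ortho_symplectic_def)
next
  assume R: "R \<in> orthogonal_group (2 * m) \<and>
    (\<forall>a<m. \<forall>b<m. R $$ (a + m, b + m) = R $$ (a, b) \<and> R $$ (a, b + m) = - R $$ (a + m, b))"
  then have dim: "R \<in> carrier_mat (2 * m) (2 * m)" by (simp add: orthogonal_group_def)
  define Ur where "Ur = mat m m (\<lambda>(a, b). R $$ (a, b))"
  define Ui where "Ui = mat m m (\<lambda>(a, b). R $$ (a + m, b))"
  have "R = four_block_mat Ur (- Ui) Ui Ur"
  proof (rule eq_matI)
    fix i j
    assume "i < dim_row (four_block_mat Ur (- Ui) Ui Ur)" "j < dim_col (four_block_mat Ur (- Ui) Ui Ur)"
    then have ij: "i < 2 * m" "j < 2 * m" by (auto simp: Ur_def)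
    show "R $$ (i, j) = four_block_mat Ur (- Ui) Ui Ur $$ (i, j)"
      using index_two_halves[OF ij(1)] index_two_halves[OF ij(2)] R
      by (auto simp: Ur_def Ui_def)
  qed (use dim in \<open>auto simp: Ur_def\<close>)
  moreover have "Ur \<in> carrier_mat m m" "Ui \<in> carrier_mat m m" by (auto simp: Ur_def Ui_def)
  ultimately show "R \<in> ortho_symplectic m"
    using R unfolding ortho_symplectic_def by blast
qed

lemma ortho_symplectic_one: "1\<^sub>m (2 * m) \<in> ortho_symplectic m"
  unfolding ortho_symplectic_iff orthogonal_group_def by auto

lemma ortho_symplectic_mult:
  assumes R: "R \<in> ortho_symplectic m" and G: "G \<in> ortho_symplectic m"
  shows "R * G \<in> ortho_symplectic m"
proof -
  let ?n = "2 * m"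
  have dim: "R \<in> carrier_mat ?n ?n" "G \<in> carrier_mat ?n ?n"
    and orth: "transpose_mat R * R = 1\<^sub>m ?n" "transpose_mat G * G = 1\<^sub>m ?n"
    using R G by (auto simp: ortho_symplectic_iff orthogonal_group_def)
  have "transpose_mat (R * G) * (R * G) = transpose_mat G * ((transpose_mat R * R) * G)"
    using dim by (simp add: transpose_mult[of R ?n ?n G ?n] assoc_mult_mat[of _ ?n ?n _ ?n _ ?n])
  also have "\<dots> = 1\<^sub>m ?n" using dim orth by simp
  finally have 1: "transpose_mat (R * G) * (R * G) = 1\<^sub>m ?n" .
  moreover have "(R * G) * transpose_mat (R * G) = 1\<^sub>m ?n"
    by (rule mat_mult_left_right_inverse[OF _ _ 1]) (use dim in auto)
  ultimately have "R * G \<in> orthogonal_group ?n" using dim by (auto simp: orthogonal_group_def)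
  moreover have "(R * G) $$ (a + m, b + m) = (R * G) $$ (a, b) \<and>
      (R * G) $$ (a, b + m) = - (R * G) $$ (a + m, b)" if "a < m" "b < m" for a b
  proof -
    have "R $$ (a + m, k + m) = R $$ (a, k) \<and> R $$ (a, k + m) = - R $$ (a + m, k) \<and>
      G $$ (k + m, b + m) = G $$ (k, b) \<and> G $$ (k, b + m) = - G $$ (k + m, b)" if "k < m" for k
      using R G that \<open>a < m\<close> \<open>b < m\<close> by (auto simp: ortho_symplectic_iff)
    then show ?thesis
      using that by (auto simp: mult_mat_entry[OF dim] sum_two_halves simp flip: sum_negf
          simp del: index_mult_mat intro!: sum.cong)
  qed
  ultimately show ?thesis by (auto simp: ortho_symplectic_iff)
qed

text \<open>The embedding of U(m) into OSp(2m) that sends \<open>g\<close> to \<open>[[Re g, - Im g], [Im g, Re g]]\<close>.  It carries the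
complex rotations \<open>1 - c v v\<^sup>*\<close> over to competitors of a maximiser in the real group.\<close>

lemma unitary_realification:
  fixes g :: "nat \<Rightarrow> nat \<Rightarrow> complex"
  assumes unitary: "\<And>a b. a < m \<Longrightarrow> b < m \<Longrightarrow>
      (\<Sum>k<m. cnj (g k a) * g k b) = (if a = b then 1 else 0)"
  shows "\<exists>G\<in>ortho_symplectic m. \<forall>a<m. \<forall>b<m.
    G $$ (a, b) = Re (g a b) \<and> G $$ (a + m, b) = Im (g a b)"
proof -
  define G where "G = mat (2 * m) (2 * m) (\<lambda>(i, j).
    if i < m then (if j < m then Re (g i j) else - Im (g i (j - m)))
    else (if j < m then Im (g (i - m) j) else Re (g (i - m) (j - m))))"
  have dim: "G \<in> carrier_mat (2 * m) (2 * m)" by (simp add: G_def)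
  have G: "G $$ (a, b) = Re (g a b)" "G $$ (a + m, b) = Im (g a b)"
    "G $$ (a, b + m) = - Im (g a b)" "G $$ (a + m, b + m) = Re (g a b)"
    if "a < m" "b < m" for a b using that by (auto simp: G_def)
  have re: "(\<Sum>k<m. Re (g k a) * Re (g k b) + Im (g k a) * Im (g k b)) = (if a = b then 1 else 0)"
    and im: "(\<Sum>k<m. Re (g k a) * Im (g k b) - Im (g k a) * Re (g k b)) = 0"
    if "a < m" "b < m" for a b
    using arg_cong[OF unitary[OF that], of Re] arg_cong[OF unitary[OF that], of Im]
    by (auto split: if_splits)
  have orth: "transpose_mat G * G = 1\<^sub>m (2 * m)"
  proof (rule eq_matI)
    fix i j
    assume "i < dim_row (1\<^sub>m (2 * m))" "j < dim_col (1\<^sub>m (2 * m))"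
    then have ij: "i < 2 * m" "j < 2 * m" by auto
    then have entry: "(transpose_mat G * G) $$ (i, j)
        = (\<Sum>k<m. G $$ (k, i) * G $$ (k, j) + G $$ (k + m, i) * G $$ (k + m, j))"
      using dim by (simp add: mult_mat_entry[of _ "2 * m" "2 * m" _ "2 * m"] sum_two_halves
        del: index_mult_mat)
    consider (ll) "i < m" "j < m" | (lr) j' where "i < m" "j' < m" "j = j' + m"
      | (rl) i' where "i' < m" "i = i' + m" "j < m"
      | (rr) i' j' where "i' < m" "i = i' + m" "j' < m" "j = j' + m"
      using index_two_halves[OF ij(1)] index_two_halves[OF ij(2)] by blast
    then show "(transpose_mat G * G) $$ (i, j) = 1\<^sub>m (2 * m) $$ (i, j)"
    proof cases
      case ll
      then show ?thesis using re[of i j] ij unfolding entry by (simp add: G)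
    next
      case lr
      then have "(transpose_mat G * G) $$ (i, j) =
        - (\<Sum>k<m. Re (g k i) * Im (g k j') - Im (g k i) * Re (g k j'))"
        unfolding entry sum_negf[symmetric] by (intro sum.cong) (auto simp: G)
      then show ?thesis using im[of i j'] ij lr by simp
    next
      case rl
      then have "(transpose_mat G * G) $$ (i, j) =
        (\<Sum>k<m. Re (g k i') * Im (g k j) - Im (g k i') * Re (g k j))"
        unfolding entry by (intro sum.cong) (auto simp: G)
      then show ?thesis using im[of i' j] ij rl by simp
    next
      case rr
      then have "(transpose_mat G * G) $$ (i, j) =
        (\<Sum>k<m. Re (g k i') * Re (g k j') + Im (g k i') * Im (g k j'))"
        unfolding entry by (intro sum.cong) (auto simp: G)
      then show ?thesis using re[of i' j'] ij rr by simp
    qed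
  qed (use dim in auto)
  have "G * transpose_mat G = 1\<^sub>m (2 * m)"
    by (rule mat_mult_left_right_inverse[OF _ _ orth]) (use dim in auto)
  then have "G \<in> ortho_symplectic m"
    using dim orth by (simp add: ortho_symplectic_iff orthogonal_group_def G)
  then show ?thesis using G by blast
qed

lemma ortho_symplectic_commute:
  fixes m :: nat and \<sigma> :: real
  defines "K \<equiv> \<sigma> \<cdot>\<^sub>m four_block_mat (0\<^sub>m m m) (- 1\<^sub>m m) (1\<^sub>m m) (0\<^sub>m m m)"
  assumes R: "R \<in> ortho_symplectic m"
  shows "K * R = R * K"
proof -
  obtain Ur Ui where U: "Ur \<in> carrier_mat m m" "Ui \<in> carrier_mat m m"
    and R_eq: "R = four_block_mat Ur (- Ui) Ui Ur"
    using R by (auto simp: ortho_symplectic_def)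
  let ?J = "four_block_mat (0\<^sub>m m m) (- 1\<^sub>m m) (1\<^sub>m m) (0\<^sub>m m m) :: real mat"
  have J: "?J \<in> carrier_mat (m + m) (m + m)" by auto
  have R': "R \<in> carrier_mat (m + m) (m + m)" using U by (auto simp: R_eq)
  have "?J * R = four_block_mat (- Ui) (- Ur) Ur (- Ui)"
    unfolding R_eq
    by (subst mult_four_block_mat[of _ m m _ m _ m _ _ m _ m]) (use U in auto)
  moreover have "R * ?J = four_block_mat (- Ui) (- Ur) Ur (- Ui)"
    unfolding R_eq
    by (subst mult_four_block_mat[of _ m m _ m _ m _ _ m _ m]) (use U in auto)
  ultimately show ?thesis
    unfolding K_def using J R'
    by (simp add: mult_smult_distrib[of _ "m + m" "m + m" _ "m + m"]
        mult_smult_assoc_mat[of _ "m + m" "m + m" _ "m + m"])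
qed

lemma orthogonal_group_iff_columns:
  assumes "R \<in> carrier_mat n n"
  shows "R \<in> orthogonal_group n \<longleftrightarrow>
    (\<forall>a<n. \<forall>b<n. (\<Sum>k<n. R $$ (k, a) * R $$ (k, b)) = (if a = b then 1 else 0))"
proof -
  have "R \<in> orthogonal_group n \<longleftrightarrow> transpose_mat R * R = 1\<^sub>m n"
    using assms mat_mult_left_right_inverse[of "transpose_mat R" n R]
    by (auto simp: orthogonal_group_def)
  also have "\<dots> \<longleftrightarrow> (\<forall>a<n. \<forall>b<n. (transpose_mat R * R) $$ (a, b) = 1\<^sub>m n $$ (a, b))"
    using assms by (auto simp del: index_mult_mat(1) simp: mat_eq_iff)
  also have "\<dots> \<longleftrightarrow> (\<forall>a<n. \<forall>b<n. (\<Sum>k<n. R $$ (k, a) * R $$ (k, b)) = (if a = b then 1 else 0))"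
    using assms by (simp add: mult_mat_entry[of _ n n _ n] del: index_mult_mat(1))
  finally show ?thesis .
qed

text \<open>Compactness comes from the product topology on functions of an index pair, which serves all matrix
sizes at once: the entries of an orthogonal matrix lie in a product of intervals, which is compact by
Tychonoff, and the defining equations of the group are closed conditions on finitely many coordinates.\<close>

lemma ortho_symplectic_attains_inf:
  fixes F :: "real mat \<Rightarrow> real"
  assumes cont: "continuous_on UNIV (\<lambda>f. F (mat (2 * m) (2 * m) f))"
  shows "\<exists>R\<in>ortho_symplectic m. \<forall>G\<in>ortho_symplectic m. F R \<le> F G"
proof -
  let ?n = "2 * m"
  define K where "K = {f :: nat \<times> nat \<Rightarrow> real. mat ?n ?n f \<in> ortho_symplectic m}"
  define B where "B = (PiE UNIV (\<lambda>_. {-1..1}) :: (nat \<times> nat \<Rightarrow> real) set)"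
  have coord: "continuous_on UNIV (\<lambda>f :: nat \<times> nat \<Rightarrow> real. f i)" for i
    by (rule continuous_on_product_coordinates)
  have "compactin (product_topology (\<lambda>_. euclidean) UNIV) B"
    unfolding B_def compactin_PiE by (simp add: compactin_euclidean_iff)
  then have "compact B"
    by (simp add: euclidean_product_topology compactin_euclidean_iff)
  moreover have "closed K"
  proof -
    have K_eq: "K = {f. (\<forall>a. a < ?n \<longrightarrow> (\<forall>b. b < ?n \<longrightarrow>
          (\<Sum>k<?n. f (k, a) * f (k, b)) = (if a = b then 1 else 0))) \<and>
        (\<forall>a. a < m \<longrightarrow> (\<forall>b. b < m \<longrightarrow> f (a + m, b + m) = f (a, b) \<and> f (a, b + m) = - f (a + m, b)))}"
      unfolding K_def ortho_symplectic_iff by (simp add: orthogonal_group_iff_columns)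
    show ?thesis
      unfolding K_eq
      by (intro closed_Collect_conj closed_Collect_all closed_Collect_imp open_Collect_const
          closed_Collect_eq continuous_on_sum continuous_on_mult continuous_on_minus
          continuous_on_const coord)
  qed
  ultimately have compact: "compact (B \<inter> K)" by (rule compact_Int_closed)
  define embed where "embed = (\<lambda>(R :: real mat) (i, j). if i < ?n \<and> j < ?n then R $$ (i, j) else 0)"
  have embed: "embed R \<in> B \<inter> K \<and> mat ?n ?n (embed R) = R" if R: "R \<in> ortho_symplectic m" for R
  proof -
    have dim: "R \<in> carrier_mat ?n ?n" and orth: "R \<in> orthogonal_group ?n"
      using R by (auto simp: ortho_symplectic_iff orthogonal_group_def)
    have mat: "mat ?n ?n (embed R) = R"
      using dim by (intro eq_matI) (auto simp: embed_def)
    have "\<bar>R $$ (i, j)\<bar> \<le> 1" if "i < ?n" "j < ?n" for i j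
    proof -
      have "(R $$ (i, j))\<^sup>2 \<le> (\<Sum>k<?n. (R $$ (k, j))\<^sup>2)"
        by (rule member_le_sum) (use that in auto)
      also have "\<dots> = 1"
        using orth that by (simp add: orthogonal_group_iff_columns[OF dim] power2_eq_square)
      finally show ?thesis by (simp add: abs_square_le_1)
    qed
    then have "embed R \<in> B"
      by (auto simp: B_def embed_def abs_le_iff split: if_splits)
    then show ?thesis using mat R by (simp add: K_def)
  qed
  have "B \<inter> K \<noteq> {}" using embed[OF ortho_symplectic_one] by blast
  then obtain f where f: "f \<in> B \<inter> K"
    and min: "\<And>h. h \<in> B \<inter> K \<Longrightarrow> F (mat ?n ?n f) \<le> F (mat ?n ?n h)"
    using continuous_attains_inf[OF compact _ continuous_on_subset[OF cont subset_UNIV]] by blast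
  show ?thesis
  proof (intro bexI[of _ "mat ?n ?n f"] ballI)
    show "mat ?n ?n f \<in> ortho_symplectic m" using f by (simp add: K_def)
    show "F (mat ?n ?n f) \<le> F G" if "G \<in> ortho_symplectic m" for G
      using min embed[OF that] by metis
  qed
qed

lemma continuous_mult_entry:
  assumes X: "X \<in> carrier_mat n k" and "i < n" "j < q"
  shows "continuous_on UNIV (\<lambda>f :: nat \<times> nat \<Rightarrow> real. (X * mat k q f) $$ (i, j))"
proof -
  have "(X * mat k q f) $$ (i, j) = (\<Sum>r<k. X $$ (i, r) * f (r, j))" for f :: "nat \<times> nat \<Rightarrow> real"
    using assms by (simp add: mult_mat_entry[of _ n k _ q] del: index_mult_mat(1))
  then show ?thesis by (auto intro!: continuous_intros continuous_on_product_coordinates)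
qed

lemma continuous_residual_norm:
  assumes A: "A \<in> carrier_mat n n" and V: "V \<in> carrier_mat n k" and B: "B \<in> carrier_mat k k"
  shows "continuous_on UNIV (\<lambda>f. frobenius_norm (A * (V * mat k k f) - (V * mat k k f) * B))"
proof -
  have "(A * (V * mat k k f) - (V * mat k k f) * B) $$ (i, j) =
      (A * V * mat k k f) $$ (i, j) - (\<Sum>r<k. (V * mat k k f) $$ (i, r) * B $$ (r, j))"
    if "i < n" "j < k" for i j f
    using A V B that
    by (simp add: mult_mat_entry[of "V * mat k k f" n k B k] assoc_mult_mat[of A n n V k _ k]
        del: index_mult_mat(1))
  then have "frobenius_norm (A * (V * mat k k f) - (V * mat k k f) * B) =
      sqrt (\<Sum>i<n. \<Sum>j<k. ((A * V * mat k k f) $$ (i, j) -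
        (\<Sum>r<k. (V * mat k k f) $$ (i, r) * B $$ (r, j)))\<^sup>2)" for f
    unfolding frobenius_norm_def using A V B by (intro arg_cong[where f = sqrt] sum.cong) auto
  then show ?thesis
    using A V by (auto intro!: continuous_intros continuous_mult_entry simp del: index_mult_mat(1))
qed

section \<open>The Schur form and the skew part\<close>

lemma schur_block_dim [simp]: "dim_row (schur_block l t) = 2" "dim_col (schur_block l t) = 2"
  by (simp_all add: schur_block_def mat_of_rows_list_def)

lemma schur_block_entries [simp]:
  "schur_block l t $$ (0, 0) = l * cos t" "schur_block l t $$ (0, Suc 0) = - (l * sin t)"
  "schur_block l t $$ (Suc 0, 0) = l * sin t" "schur_block l t $$ (Suc 0, Suc 0) = l * cos t"
  by (simp_all add: schur_block_def mat_of_rows_list_def)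

lemma diag_block_mat_entry:
  assumes "\<forall>B\<in>set Bs. B \<in> carrier_mat 2 2"
  shows "diag_block_mat Bs \<in> carrier_mat (2 * length Bs) (2 * length Bs)"
    and "r < 2 * length Bs \<Longrightarrow> c < 2 * length Bs \<Longrightarrow>
      diag_block_mat Bs $$ (r, c) = (if r div 2 = c div 2 then (Bs ! (r div 2)) $$ (r mod 2, c mod 2) else 0)"
  using assms
proof (induction Bs arbitrary: r c)
  case (Cons B Bs)
  { case 1
    then show ?case using Cons.IH(1) by (auto simp: Let_def)
  next
    case 2
    have dim: "diag_block_mat Bs \<in> carrier_mat (2 * length Bs) (2 * length Bs)"
      and B: "B \<in> carrier_mat 2 2"
      using Cons.IH(1) 2 by auto
    have small: "x < 2 \<Longrightarrow> x div 2 = 0 \<and> x mod 2 = x"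
      and large: "\<not> x < 2 \<Longrightarrow> x div 2 = Suc ((x - 2) div 2) \<and> x mod 2 = (x - 2) mod 2" for x :: nat
      by (auto simp: le_div_geq le_mod_geq not_less)
    show ?case
      using 2 dim B small[of r] small[of c] large[of r] large[of c] Cons.IH(2)[of "r - 2" "c - 2"]
      by (auto simp: Let_def)
  }
qed auto

lemma schur_form_entries:
  assumes "S = diag_block_mat (map (\<lambda>j. schur_block (l j) (t j)) [1..<p + 1])"
  shows "S \<in> carrier_mat (2 * p) (2 * p)"
    and "i \<in> {1..p} \<Longrightarrow> j \<in> {1..p} \<Longrightarrow>
      S $$ (2 * i - 2, 2 * j - 2) = (if i = j then l i * cos (t i) else 0) \<and>
      S $$ (2 * i - 2, 2 * j - 1) = (if i = j then - (l i * sin (t i)) else 0) \<and>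
      S $$ (2 * i - 1, 2 * j - 2) = (if i = j then l i * sin (t i) else 0) \<and>
      S $$ (2 * i - 1, 2 * j - 1) = (if i = j then l i * cos (t i) else 0)"
proof -
  let ?Bs = "map (\<lambda>j. schur_block (l j) (t j)) [1..<p + 1]"
  have blocks: "\<forall>B\<in>set ?Bs. B \<in> carrier_mat 2 2"
    unfolding set_map by (blast intro: carrier_matI schur_block_dim)
  show "S \<in> carrier_mat (2 * p) (2 * p)"
    using diag_block_mat_entry(1)[OF blocks] assms by (simp del: upt_Suc)
  assume ij: "i \<in> {1..p}" "j \<in> {1..p}"
  then obtain i' j' where ij': "i = Suc i'" "j = Suc j'"
    by (metis atLeastAtMost_iff not_one_le_zero old.nat.exhaust)
  then have lt: "i' < p" "j' < p" using ij by auto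
  have "S $$ (r, c) = (if r div 2 = c div 2 then (?Bs ! (r div 2)) $$ (r mod 2, c mod 2) else 0)"
    if "r < 2 * p" "c < 2 * p" for r c
    unfolding assms by (rule diag_block_mat_entry(2)[OF blocks]) (use that in \<open>simp_all del: upt_Suc\<close>)
  then show "S $$ (2 * i - 2, 2 * j - 2) = (if i = j then l i * cos (t i) else 0) \<and>
      S $$ (2 * i - 2, 2 * j - 1) = (if i = j then - (l i * sin (t i)) else 0) \<and>
      S $$ (2 * i - 1, 2 * j - 2) = (if i = j then l i * sin (t i) else 0) \<and>
      S $$ (2 * i - 1, 2 * j - 1) = (if i = j then l i * cos (t i) else 0)"
    using lt by (auto simp: ij' simp del: upt_Suc)
qed

lemma skew_part_entry:
  assumes "A \<in> carrier_mat n n" "i < n" "j < n"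
  shows "skew_part A $$ (i, j) = (A $$ (i, j) - A $$ (j, i)) / 2"
  using assms by (simp add: skew_part_def)

lemma skew_part_carrier: "A \<in> carrier_mat n n \<Longrightarrow> skew_part A \<in> carrier_mat n n"
  unfolding skew_part_def by (intro smult_carrier_mat minus_carrier_mat) auto

lemma skew_part_similarity:
  assumes Q: "Q \<in> carrier_mat n n" "transpose_mat Q * Q = 1\<^sub>m n" and S: "S \<in> carrier_mat n n"
  shows "transpose_mat Q * skew_part (Q * S * transpose_mat Q) = skew_part S * transpose_mat Q"
proof -
  let ?Q' = "transpose_mat Q" and ?S' = "transpose_mat S"
  have Q': "?Q' \<in> carrier_mat n n" and S': "?S' \<in> carrier_mat n n" using Q S by auto
  have cancel: "?Q' * (Q * X * ?Q') = X * ?Q'" if X: "X \<in> carrier_mat n n" for X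
  proof -
    have "?Q' * (Q * X * ?Q') = (?Q' * Q) * (X * ?Q')"
      using Q(1) Q' X by (simp add: assoc_mult_mat[of _ n n _ n _ n])
    then show ?thesis using Q(2) Q' X by simp
  qed
  have "transpose_mat (Q * S * ?Q') = Q * ?S' * ?Q'"
    using Q(1) Q' S S' by (simp add: transpose_mult[of _ n n _ n] assoc_mult_mat[of _ n n _ n _ n])
  moreover define X Y where "X = Q * S * ?Q'" and "Y = Q * ?S' * ?Q'"
  moreover have XY: "X \<in> carrier_mat n n" "Y \<in> carrier_mat n n"
    using Q(1) Q' S S' by (auto simp: X_def Y_def)
  ultimately have "?Q' * skew_part (Q * S * ?Q') = ?Q' * ((1 / 2) \<cdot>\<^sub>m (X - Y))"
    by (simp add: skew_part_def)
  also have "\<dots> = (1 / 2) \<cdot>\<^sub>m (?Q' * (X - Y))"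
    by (rule mult_smult_distrib[OF Q']) (use XY in auto)
  also have "\<dots> = (1 / 2) \<cdot>\<^sub>m (?Q' * X - ?Q' * Y)"
    unfolding mult_minus_distrib_mat[OF Q' XY] ..
  also have "\<dots> = (1 / 2) \<cdot>\<^sub>m (S * ?Q' - ?S' * ?Q')"
    unfolding X_def Y_def cancel[OF S] cancel[OF S'] ..
  also have "\<dots> = (1 / 2) \<cdot>\<^sub>m ((S - ?S') * ?Q')"
    unfolding minus_mult_distrib_mat[OF S S' Q'] ..
  also have "\<dots> = skew_part S * ?Q'"
    unfolding skew_part_def by (rule mult_smult_assoc_mat[symmetric, OF _ Q']) (use S' in auto)
  finally show ?thesis .
qed

lemma intertwined_residual:
  fixes X Y Q Z B :: "real mat"
  assumes dims: "X \<in> carrier_mat n n" "Y \<in> carrier_mat n n" "Q \<in> carrier_mat n n"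
      "Z \<in> carrier_mat n k" "B \<in> carrier_mat k k"
    and intertwine: "Q * X = Y * Q"
  shows "Q * (X * Z - Z * B) = Y * (Q * Z) - (Q * Z) * B"
proof -
  have "Q * (X * Z - Z * B) = Q * (X * Z) - Q * (Z * B)"
    using dims by (intro mult_minus_distrib_mat) auto
  also have "Q * (X * Z) = Y * (Q * Z)"
    using assoc_mult_mat[OF dims(3,1,4)] assoc_mult_mat[OF dims(2,3,4)] intertwine by simp
  also have "Q * (Z * B) = (Q * Z) * B"
    using assoc_mult_mat[OF dims(3,4,5)] by simp
  finally show ?thesis .
qed

section \<open>Linear and antilinear parts of the blocks\<close>

text \<open>Block \<open>(j, k)\<close> of \<open>W\<close> has the rows \<open>2 j - 2\<close>, \<open>2 j - 1\<close> (Schur blocks are counted from 1, matrix rows from 0)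
and the columns \<open>k\<close>, \<open>k + m\<close>.  As a real-linear map on complex numbers it is
\<open>z \<mapsto> linear_part \<cdot> z + antilinear_part \<cdot> cnj z\<close>.\<close>

definition linear_part :: "nat \<Rightarrow> real mat \<Rightarrow> nat \<Rightarrow> nat \<Rightarrow> complex" where
  "linear_part m W j k =
    Complex ((W $$ (2 * j - 2, k) + W $$ (2 * j - 1, k + m)) / 2)
            ((W $$ (2 * j - 1, k) - W $$ (2 * j - 2, k + m)) / 2)"

definition antilinear_part :: "nat \<Rightarrow> real mat \<Rightarrow> nat \<Rightarrow> nat \<Rightarrow> complex" where
  "antilinear_part m W j k =
    Complex ((W $$ (2 * j - 2, k) - W $$ (2 * j - 1, k + m)) / 2)
            ((W $$ (2 * j - 1, k) + W $$ (2 * j - 2, k + m)) / 2)"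

text \<open>The identity \<open>P\<^sup>* P + N\<^sup>T cnj N = 1\<close>.  It is the complex-linear component of \<open>W\<^sup>T W = 1\<close>: the products of \<open>P\<close>
with \<open>N\<close> are antilinear and drop out.\<close>

lemma stiefel_parts_gram:
  assumes W: "W \<in> stiefel (2 * p) (2 * m)" and kl: "k < m" "l < m"
  shows "(\<Sum>j\<in>{1..p}. cnj (linear_part m W j k) * linear_part m W j l +
      antilinear_part m W j k * cnj (antilinear_part m W j l)) = (if k = l then 1 else 0)"
proof -
  have dim: "W \<in> carrier_mat (2 * p) (2 * m)" and orth: "transpose_mat W * W = 1\<^sub>m (2 * m)"
    using W by (auto simp: stiefel_def)
  have gram: "(\<Sum>j\<in>{1..p}. W $$ (2 * j - 2, x) * W $$ (2 * j - 2, y) +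
      W $$ (2 * j - 1, x) * W $$ (2 * j - 1, y)) = (if x = y then 1 else 0)"
    if "x < 2 * m" "y < 2 * m" for x y
  proof -
    have "(\<Sum>r<2 * p. W $$ (r, x) * W $$ (r, y)) = (transpose_mat W * W) $$ (x, y)"
      using dim that
      by (simp add: mult_mat_entry[of _ "2 * m" "2 * p" _ "2 * m"] del: index_mult_mat(1))
    then show ?thesis using that unfolding orth sum_consecutive_pairs by simp
  qed
  have lt: "k < 2 * m" "l < 2 * m" "k + m < 2 * m" "l + m < 2 * m" using kl by auto
  show ?thesis
  proof (rule complex_eqI)
    have "Re (\<Sum>j\<in>{1..p}. cnj (linear_part m W j k) * linear_part m W j l +
        antilinear_part m W j k * cnj (antilinear_part m W j l)) =
      ((\<Sum>j\<in>{1..p}. W $$ (2 * j - 2, k) * W $$ (2 * j - 2, l) +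
          W $$ (2 * j - 1, k) * W $$ (2 * j - 1, l)) +
       (\<Sum>j\<in>{1..p}. W $$ (2 * j - 2, k + m) * W $$ (2 * j - 2, l + m) +
          W $$ (2 * j - 1, k + m) * W $$ (2 * j - 1, l + m))) / 2"
      unfolding Re_sum sum.distrib[symmetric] sum_divide_distrib
      by (rule sum.cong) (simp_all add: linear_part_def antilinear_part_def field_simps)
    then show "Re (\<Sum>j\<in>{1..p}. cnj (linear_part m W j k) * linear_part m W j l +
        antilinear_part m W j k * cnj (antilinear_part m W j l)) = Re (if k = l then 1 else 0)"
      unfolding gram[OF lt(1,2)] gram[OF lt(3,4)] by simp
    have "Im (\<Sum>j\<in>{1..p}. cnj (linear_part m W j k) * linear_part m W j l +
        antilinear_part m W j k * cnj (antilinear_part m W j l)) =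
      ((\<Sum>j\<in>{1..p}. W $$ (2 * j - 2, k + m) * W $$ (2 * j - 2, l) +
          W $$ (2 * j - 1, k + m) * W $$ (2 * j - 1, l)) -
       (\<Sum>j\<in>{1..p}. W $$ (2 * j - 2, k) * W $$ (2 * j - 2, l + m) +
          W $$ (2 * j - 1, k) * W $$ (2 * j - 1, l + m))) / 2"
      unfolding Im_sum sum_subtractf[symmetric] sum_divide_distrib
      by (rule sum.cong) (simp_all add: linear_part_def antilinear_part_def field_simps)
    then show "Im (\<Sum>j\<in>{1..p}. cnj (linear_part m W j k) * linear_part m W j l +
        antilinear_part m W j k * cnj (antilinear_part m W j l)) = Im (if k = l then 1 else 0)"
      unfolding gram[OF lt(3,2)] gram[OF lt(1,4)] using kl by simp
  qed
qed

text \<open>The map \<open>X \<mapsto> (h + \<i> w) X - X (\<mu> + \<i> \<sigma>)\<close> on one block acts diagonally: it scales the linear part by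
\<open>(h - \<mu>) + \<i> (w - \<sigma>)\<close> and the antilinear part by \<open>(h - \<mu>) + \<i> (w + \<sigma>)\<close>, because \<open>cnj\<close> turns
\<open>\<sigma>\<close> into \<open>- \<sigma>\<close>.  The two parts are orthogonal and each has squared Frobenius norm twice its squared modulus.\<close>

lemma block_sylvester_norm:
  fixes a b c d h w \<mu> \<sigma> :: real
  shows "(h * a - w * c - (\<mu> * a + \<sigma> * b))\<^sup>2 + (h * b - w * d - (\<mu> * b - \<sigma> * a))\<^sup>2 +
    ((w * a + h * c - (\<mu> * c + \<sigma> * d))\<^sup>2 + (w * b + h * d - (\<mu> * d - \<sigma> * c))\<^sup>2) =
    2 * (((h - \<mu>)\<^sup>2 + (w - \<sigma>)\<^sup>2) * (((a + d) / 2)\<^sup>2 + ((c - b) / 2)\<^sup>2) +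
         ((h - \<mu>)\<^sup>2 + (w + \<sigma>)\<^sup>2) * (((a - d) / 2)\<^sup>2 + ((c + b) / 2)\<^sup>2))"
proof -
  define x u y v where "x = (a + d) / 2" and "u = (a - d) / 2"
    and "y = (c - b) / 2" and "v = (c + b) / 2"
  have abcd: "a = x + u" "d = x - u" "c = v + y" "b = v - y"
    by (simp_all add: x_def u_def y_def v_def field_simps)
  show ?thesis
    unfolding x_def[symmetric] u_def[symmetric] y_def[symmetric] v_def[symmetric]
    unfolding abcd by (simp add: power2_eq_square algebra_simps)
qed

text \<open>Applied twice: to the Schur form itself it evaluates the norm of the residual, and with \<open>h = 0\<close>, \<open>D = 0\<close> to its skew part
it evaluates the norm of \<open>E\<close>.\<close>

lemma sylvester_norm:
  fixes T W D :: "real mat" and h w :: "nat \<Rightarrow> real"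
  assumes T: "T \<in> carrier_mat (2 * p) (2 * p)"
    and T_entries: "\<And>i j. i \<in> {1..p} \<Longrightarrow> j \<in> {1..p} \<Longrightarrow>
      T $$ (2 * i - 2, 2 * j - 2) = (if i = j then h i else 0) \<and>
      T $$ (2 * i - 2, 2 * j - 1) = (if i = j then - w i else 0) \<and>
      T $$ (2 * i - 1, 2 * j - 2) = (if i = j then w i else 0) \<and>
      T $$ (2 * i - 1, 2 * j - 1) = (if i = j then h i else 0)"
    and W: "W \<in> carrier_mat (2 * p) (2 * m)"
    and D: "D \<in> carrier_mat m m" "diagonal_mat D"
  shows "(frobenius_norm (T * W - W * four_block_mat D (- (\<sigma> \<cdot>\<^sub>m 1\<^sub>m m)) (\<sigma> \<cdot>\<^sub>m 1\<^sub>m m) D))\<^sup>2 =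
    (\<Sum>j\<in>{1..p}. \<Sum>k<m.
      2 * (((h j - D $$ (k, k))\<^sup>2 + (w j - \<sigma>)\<^sup>2) * (cmod (linear_part m W j k))\<^sup>2 +
           ((h j - D $$ (k, k))\<^sup>2 + (w j + \<sigma>)\<^sup>2) * (cmod (antilinear_part m W j k))\<^sup>2))"
proof -
  define B where "B = four_block_mat D (- (\<sigma> \<cdot>\<^sub>m 1\<^sub>m m)) (\<sigma> \<cdot>\<^sub>m 1\<^sub>m m) D"
  define X where "X = T * W - W * B"
  have B: "B \<in> carrier_mat (2 * m) (2 * m)" using D(1) by (auto simp: B_def mult_2)
  have X: "X \<in> carrier_mat (2 * p) (2 * m)" using T W B by (auto simp: X_def)
  have D_off: "D $$ (a, b) = (if a = b then D $$ (b, b) else 0)" if "a < m" "b < m" for a b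
    using D that by (auto simp: diagonal_mat_def)
  have B_entries: "B $$ (a, b) = (if a = b then D $$ (b, b) else 0)"
    "B $$ (a + m, b) = (if a = b then \<sigma> else 0)"
    "B $$ (a, b + m) = (if a = b then - \<sigma> else 0)"
    "B $$ (a + m, b + m) = (if a = b then D $$ (b, b) else 0)"
    if "a < m" "b < m" for a b
    using that D(1) D_off[OF that] by (auto simp: B_def)
  have WB: "(W * B) $$ (r, k) = D $$ (k, k) * W $$ (r, k) + \<sigma> * W $$ (r, k + m)"
    "(W * B) $$ (r, k + m) = D $$ (k, k) * W $$ (r, k + m) - \<sigma> * W $$ (r, k)"
    if "r < 2 * p" "k < m" for r k
    using that
    by (simp_all add: mult_mat_entry[OF W B] sum_two_halves B_entries if_distrib sum.distrib
        cong: if_cong del: index_mult_mat(1))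
  have TW: "(T * W) $$ (2 * i - 2, k) = h i * W $$ (2 * i - 2, k) - w i * W $$ (2 * i - 1, k)"
    "(T * W) $$ (2 * i - 1, k) = w i * W $$ (2 * i - 2, k) + h i * W $$ (2 * i - 1, k)"
    if i: "i \<in> {1..p}" and k: "k < 2 * m" for i k
  proof -
    have rows: "2 * i - 2 < 2 * p" "2 * i - 1 < 2 * p" using i by auto
    have "(T * W) $$ (2 * i - 2, k) =
      (\<Sum>j\<in>{1..p}. if j = i then h i * W $$ (2 * i - 2, k) - w i * W $$ (2 * i - 1, k) else 0)"
      unfolding mult_mat_entry[OF T W rows(1) k] sum_consecutive_pairs
      by (rule sum.cong) (use T_entries[OF i] in auto)
    then show "(T * W) $$ (2 * i - 2, k) = h i * W $$ (2 * i - 2, k) - w i * W $$ (2 * i - 1, k)"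
      using i by simp
    have "(T * W) $$ (2 * i - 1, k) =
      (\<Sum>j\<in>{1..p}. if j = i then w i * W $$ (2 * i - 2, k) + h i * W $$ (2 * i - 1, k) else 0)"
      unfolding mult_mat_entry[OF T W rows(2) k] sum_consecutive_pairs
      by (rule sum.cong) (use T_entries[OF i] in auto)
    then show "(T * W) $$ (2 * i - 1, k) = w i * W $$ (2 * i - 2, k) + h i * W $$ (2 * i - 1, k)"
      using i by simp
  qed
  have entry: "X $$ (r, k) = (T * W) $$ (r, k) - (W * B) $$ (r, k)" if "r < 2 * p" "k < 2 * m" for r k
    using that T W B by (simp add: X_def del: index_mult_mat(1))
  have "(frobenius_norm X)\<^sup>2 = (\<Sum>j\<in>{1..p}. \<Sum>k<m.
      (X $$ (2 * j - 2, k))\<^sup>2 + (X $$ (2 * j - 2, k + m))\<^sup>2 +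
      ((X $$ (2 * j - 1, k))\<^sup>2 + (X $$ (2 * j - 1, k + m))\<^sup>2))"
    unfolding frobenius_norm_sq[OF X] sum_consecutive_pairs[of _ p] sum_two_halves[of _ m]
      sum.distrib by (simp only: ac_simps)
  also have "\<dots> = (\<Sum>j\<in>{1..p}. \<Sum>k<m.
      2 * (((h j - D $$ (k, k))\<^sup>2 + (w j - \<sigma>)\<^sup>2) * (cmod (linear_part m W j k))\<^sup>2 +
           ((h j - D $$ (k, k))\<^sup>2 + (w j + \<sigma>)\<^sup>2) * (cmod (antilinear_part m W j k))\<^sup>2))"
  proof (intro sum.cong refl)
    fix j k assume jk: "j \<in> {1..p}" "k \<in> {..<m}"
    then have lt: "2 * j - 2 < 2 * p" "2 * j - 1 < 2 * p" "k < m" "k < 2 * m" "k + m < 2 * m"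
      by auto
    show "(X $$ (2 * j - 2, k))\<^sup>2 + (X $$ (2 * j - 2, k + m))\<^sup>2 +
      ((X $$ (2 * j - 1, k))\<^sup>2 + (X $$ (2 * j - 1, k + m))\<^sup>2) =
      2 * (((h j - D $$ (k, k))\<^sup>2 + (w j - \<sigma>)\<^sup>2) * (cmod (linear_part m W j k))\<^sup>2 +
           ((h j - D $$ (k, k))\<^sup>2 + (w j + \<sigma>)\<^sup>2) * (cmod (antilinear_part m W j k))\<^sup>2)"
      unfolding entry[OF lt(1,4)] entry[OF lt(1,5)] entry[OF lt(2,4)] entry[OF lt(2,5)]
        TW[OF jk(1) lt(4)] TW[OF jk(1) lt(5)] WB[OF lt(1,3)] WB[OF lt(2,3)]
        cmod_power2 linear_part_def antilinear_part_def complex.sel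
      by (rule block_sylvester_norm)
  qed
  finally show ?thesis unfolding X_def B_def .
qed

text \<open>The real objective below is \<open>2 Re tr M\<close> for the complex matrix \<open>M a b = linear_part m W (\<pi> a) b\<close>, and
right multiplication of \<open>W\<close> by the realification of \<open>g\<close> turns \<open>M\<close> into \<open>M g\<close>.\<close>

lemma maximal_trace_linear_part:
  assumes W: "W \<in> carrier_mat (2 * p) (2 * m)" and \<pi>: "\<And>k. k < m \<Longrightarrow> \<pi> k \<in> {1..p}"
    and maximal: "\<And>G. G \<in> ortho_symplectic m \<Longrightarrow>
      (\<Sum>k<m. (W * G) $$ (2 * \<pi> k - 2, k) + (W * G) $$ (2 * \<pi> k - 1, k + m))
        \<le> (\<Sum>k<m. W $$ (2 * \<pi> k - 2, k) + W $$ (2 * \<pi> k - 1, k + m))"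
  defines "z \<equiv> \<lambda>v. \<Sum>a<m. \<Sum>b<m. cnj (v a) * linear_part m W (\<pi> a) b * v b"
  shows "Im (z v) = 0 \<and> 0 \<le> Re (z v)"
  unfolding z_def
proof (rule maximal_trace_quadratic_form)
  fix g :: "nat \<Rightarrow> nat \<Rightarrow> complex"
  assume "\<And>a b. a < m \<Longrightarrow> b < m \<Longrightarrow> (\<Sum>k<m. cnj (g k a) * g k b) = (if a = b then 1 else 0)"
  from unitary_realification[of m g, OF this] obtain G where G: "G \<in> ortho_symplectic m"
    and Gre: "\<And>a b. a < m \<Longrightarrow> b < m \<Longrightarrow> G $$ (a, b) = Re (g a b)"
    and Gim: "\<And>a b. a < m \<Longrightarrow> b < m \<Longrightarrow> G $$ (a + m, b) = Im (g a b)"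
    by blast
  have dim: "G \<in> carrier_mat (2 * m) (2 * m)"
    using G by (auto simp: ortho_symplectic_iff orthogonal_group_def)
  have G': "G $$ (a, b + m) = - Im (g a b)" "G $$ (a + m, b + m) = Re (g a b)"
    if "a < m" "b < m" for a b
    using G Gre[OF that] Gim[OF that] that by (auto simp: ortho_symplectic_iff)
  have "(W * G) $$ (2 * \<pi> k - 2, k) + (W * G) $$ (2 * \<pi> k - 1, k + m)
      = (\<Sum>b<m. 2 * Re (linear_part m W (\<pi> k) b * g b k))" if k: "k < m" for k
  proof -
    have lt: "2 * \<pi> k - 2 < 2 * p" "2 * \<pi> k - 1 < 2 * p" "k < 2 * m" "k + m < 2 * m"
      using \<pi>[OF k] k by auto
    show ?thesis
      unfolding mult_mat_entry[OF W dim lt(1,3)] mult_mat_entry[OF W dim lt(2,4)] sum_two_halves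
        sum.distrib[symmetric]
      by (rule sum.cong)
        (simp_all add: Gre Gim G' k linear_part_def field_simps)
  qed
  then have "2 * Re (\<Sum>a<m. \<Sum>b<m. linear_part m W (\<pi> a) b * g b a)
      = (\<Sum>k<m. (W * G) $$ (2 * \<pi> k - 2, k) + (W * G) $$ (2 * \<pi> k - 1, k + m))"
    by (simp add: sum_distrib_left)
  also have "\<dots> \<le> (\<Sum>k<m. W $$ (2 * \<pi> k - 2, k) + W $$ (2 * \<pi> k - 1, k + m))"
    by (rule maximal[OF G])
  also have "\<dots> = 2 * Re (\<Sum>a<m. linear_part m W (\<pi> a) a)"
    unfolding Re_sum sum_distrib_left by (rule sum.cong) (simp_all add: linear_part_def)
  finally show "Re (\<Sum>a<m. \<Sum>b<m. linear_part m W (\<pi> a) b * g b a) \<le> Re (\<Sum>a<m. linear_part m W (\<pi> a) a)"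
    by simp
qed

section \<open>The residual bound for an aligned basis\<close>

text \<open>By the Gram identity, the rows of \<open>P\<close> in \<open>K - I\<close> fail to be an isometry only through the remaining rows of
\<open>P\<close> and through \<open>N\<close>, and quadratically in their entries, which are the ones that \<open>E\<close> controls.\<close>

lemma gram_defect_bound:
  fixes P N :: "nat \<Rightarrow> nat \<Rightarrow> complex"
  assumes fin: "finite I" "finite K" "I \<subseteq> K"
    and gram: "\<And>k l. k < m \<Longrightarrow> l < m \<Longrightarrow>
      (\<Sum>j\<in>K. cnj (P j k) * P j l + N j k * cnj (N j l)) = (if k = l then 1 else 0)"
    and kl: "k < m" "l < m"
  defines "\<theta> \<equiv> (\<Sum>i\<in>I. \<Sum>k<m. (cmod (P i k))\<^sup>2) + (\<Sum>j\<in>K. \<Sum>k<m. (cmod (N j k))\<^sup>2)"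
  shows "cmod ((if k = l then 1 else 0) - (\<Sum>j\<in>K - I. cnj (P j k) * P j l)) \<le> \<theta>"
proof -
  have split: "(\<Sum>j\<in>K. f j) = (\<Sum>j\<in>I. f j) + (\<Sum>j\<in>K - I. f j)" for f :: "nat \<Rightarrow> complex"
    using fin by (metis add.commute sum.subset_diff)
  have "(if k = l then 1 else 0) - (\<Sum>j\<in>K - I. cnj (P j k) * P j l) =
      (\<Sum>i\<in>I. cnj (P i k) * P i l) + (\<Sum>j\<in>K. N j k * cnj (N j l))"
    unfolding gram[OF kl, symmetric] sum.distrib split[of "\<lambda>j. cnj (P j k) * P j l"] by simp
  also have "cmod \<dots> \<le> (\<Sum>i\<in>I. cmod (cnj (P i k) * P i l)) + (\<Sum>j\<in>K. cmod (N j k * cnj (N j l)))"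
    by (intro order_trans[OF norm_triangle_ineq] add_mono norm_sum)
  also have "\<dots> \<le> \<theta>"
  proof -
    have "cmod (x k) * cmod (x l) \<le> (\<Sum>k<m. (cmod (x k))\<^sup>2)" for x :: "nat \<Rightarrow> complex"
    proof -
      have "2 * (cmod (x k) * cmod (x l)) \<le> (cmod (x k))\<^sup>2 + (cmod (x l))\<^sup>2"
        using sum_squares_bound[of "cmod (x k)" "cmod (x l)"] by simp
      moreover have "(cmod (x i))\<^sup>2 \<le> (\<Sum>k<m. (cmod (x k))\<^sup>2)" if "i < m" for i
        by (rule member_le_sum) (use that in auto)
      note this[OF kl(1)] this[OF kl(2)]
      ultimately show ?thesis by linarith
    qed
    then show ?thesis
      unfolding \<theta>_def norm_mult complex_mod_cnj by (intro add_mono sum_mono)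
  qed
  finally show ?thesis .
qed

text \<open>The estimate in complex coordinates.  Here \<open>e\<close> and \<open>r\<close> stand for the norms of \<open>E\<close> and of the residual, \<open>psd\<close> expresses
that the basis has been aligned, and \<open>\<kappa>\<close> is a lower bound for the weights of all entries other than the
linear part over \<open>J\<close>.\<close>

lemma aligned_residual_bound:
  fixes P N :: "nat \<Rightarrow> nat \<Rightarrow> complex" and h w :: "nat \<Rightarrow> real"
  assumes \<pi>: "bij_betw \<pi> {..<m} J" and fin: "finite K" "J \<subseteq> K" and I: "I = K - J"
    and gram: "\<And>k l. k < m \<Longrightarrow> l < m \<Longrightarrow>
      (\<Sum>j\<in>K. cnj (P j k) * P j l + N j k * cnj (N j l)) = (if k = l then 1 else 0)"
    and psd: "\<And>v. Im (\<Sum>a<m. \<Sum>b<m. cnj (v a) * P (\<pi> a) b * v b) = 0 \<and>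
        0 \<le> Re (\<Sum>a<m. \<Sum>b<m. cnj (v a) * P (\<pi> a) b * v b)"
    and w: "\<And>j. j \<in> K \<Longrightarrow> 0 < w j" "\<And>j. j \<in> J \<Longrightarrow> w j = \<sigma>" and \<sigma>: "0 < \<sigma>"
    and \<kappa>: "0 < \<kappa>" "\<kappa> \<le> \<sigma>\<^sup>2" "\<And>i. i \<in> I \<Longrightarrow> \<kappa> \<le> (w i - \<sigma>)\<^sup>2"
    and \<delta>: "0 < \<delta>" "\<And>i. i \<in> I \<Longrightarrow> \<delta> \<le> \<bar>w i - \<sigma>\<bar>"
    and \<alpha>: "0 \<le> \<alpha>" "\<And>i j. i \<in> I \<Longrightarrow> j \<in> J \<Longrightarrow> \<bar>h i - h j\<bar> \<le> \<alpha>"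
    and \<beta>: "0 \<le> \<beta>" "\<And>i j. i \<in> J \<Longrightarrow> j \<in> J \<Longrightarrow> \<bar>h i - h j\<bar> \<le> \<beta>"
    and e: "0 \<le> e" "e\<^sup>2 = (\<Sum>j\<in>K. \<Sum>k<m. 2 * ((w j - \<sigma>)\<^sup>2 * (cmod (P j k))\<^sup>2 +
        (w j + \<sigma>)\<^sup>2 * (cmod (N j k))\<^sup>2))"
    and r: "0 \<le> r" "r\<^sup>2 = (\<Sum>j\<in>K. \<Sum>k<m.
      2 * (((h j - h (\<pi> k))\<^sup>2 + (w j - \<sigma>)\<^sup>2) * (cmod (P j k))\<^sup>2 +
           ((h j - h (\<pi> k))\<^sup>2 + (w j + \<sigma>)\<^sup>2) * (cmod (N j k))\<^sup>2))"
  shows "r \<le> e * (1 + \<alpha> / \<delta> + \<beta> / \<sigma>) + \<beta> * real m * e\<^sup>2 / \<kappa>"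
proof -
  define \<theta> where
    "\<theta> = (\<Sum>i\<in>I. \<Sum>k<m. (cmod (P i k))\<^sup>2) + (\<Sum>j\<in>K. \<Sum>k<m. (cmod (N j k))\<^sup>2)"
  define C where "C = 1 + (\<alpha> / \<delta>)\<^sup>2 + (\<beta> / \<sigma>)\<^sup>2"
  have I_sub: "I \<subseteq> K" and KI: "K - I = J" using I fin by auto
  have \<pi>J: "\<pi> k \<in> J" if "k < m" for k using \<pi> that by (auto simp: bij_betw_def)
  have extend: "(\<Sum>i\<in>I. f i) = (\<Sum>j\<in>K. if j \<in> I then f j else 0)"
    "(\<Sum>i\<in>J. f i) = (\<Sum>j\<in>K. if j \<in> J then f j else 0)" for f :: "nat \<Rightarrow> real"
    using fin I_sub by (simp_all add: sum.If_cases Int_absorb1)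

  \<comment> \<open>\<open>\<theta>\<close> collects the entries that \<open>E\<close> controls, whence \<open>\<theta> = O(e\<^sup>2)\<close>\<close>
  have "2 * \<kappa> * \<theta> = (\<Sum>j\<in>K. \<Sum>k<m. 2 * ((if j \<in> I then \<kappa> * (cmod (P j k))\<^sup>2 else 0)
      + \<kappa> * (cmod (N j k))\<^sup>2))"
    unfolding \<theta>_def extend sum.distrib[symmetric] sum_distrib_left
    by (rule sum.cong) (auto simp: sum_distrib_left sum.distrib algebra_simps)
  also have "\<dots> \<le> e\<^sup>2"
    unfolding e(2)
  proof (intro sum_mono mult_left_mono add_mono)
    fix j k assume j: "j \<in> K"
    show "(if j \<in> I then \<kappa> * (cmod (P j k))\<^sup>2 else 0) \<le> (w j - \<sigma>)\<^sup>2 * (cmod (P j k))\<^sup>2"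
      using \<kappa>(3) by (auto intro: mult_right_mono)
    have "\<sigma>\<^sup>2 \<le> (w j + \<sigma>)\<^sup>2" using w(1)[OF j] \<sigma> by (intro power_mono) auto
    then show "\<kappa> * (cmod (N j k))\<^sup>2 \<le> (w j + \<sigma>)\<^sup>2 * (cmod (N j k))\<^sup>2"
      using \<kappa>(2) by (intro mult_right_mono) auto
  qed auto
  finally have \<theta>_le: "2 * \<kappa> * \<theta> \<le> e\<^sup>2" .
  have \<theta>_nonneg: "0 \<le> \<theta>" by (simp add: \<theta>_def sum_nonneg)

  have hermitian: "P (\<pi> a) b = cnj (P (\<pi> b) a)" if "a < m" "b < m" for a b
    using real_quadratic_form_hermitian[of "\<lambda>a b. P (\<pi> a) b" m a b] psd that by blast
  have "(\<Sum>a<m. \<Sum>b<m. (cmod ((if a = b then 1 else 0) - P (\<pi> a) b))\<^sup>2)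
    \<le> (\<Sum>a<m. \<Sum>b<m. (cmod ((if a = b then 1 else 0) - (\<Sum>k<m. cnj (P (\<pi> k) a) * P (\<pi> k) b)))\<^sup>2)"
    by (rule psd_distance_to_one) (use hermitian psd in blast)+
  also have "\<dots> \<le> (\<Sum>a<m. \<Sum>b<m. \<theta>\<^sup>2)"
  proof (intro sum_mono power_mono)
    fix a b assume ab: "a \<in> {..<m}" "b \<in> {..<m}"
    have "(\<Sum>k<m. cnj (P (\<pi> k) a) * P (\<pi> k) b) = (\<Sum>j\<in>K - I. cnj (P j a) * P j b)"
      unfolding KI using \<pi> by (rule sum.reindex_bij_betw)
    moreover have "cmod ((if a = b then 1 else 0) - (\<Sum>j\<in>K - I. cnj (P j a) * P j b)) \<le> \<theta>"
      unfolding \<theta>_def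
      by (rule gram_defect_bound[OF finite_subset[OF I_sub fin(1)] fin(1) I_sub gram])
        (use ab in auto)
    ultimately show "cmod ((if a = b then 1 else 0) - (\<Sum>k<m. cnj (P (\<pi> k) a) * P (\<pi> k) b)) \<le> \<theta>"
      by simp
  qed auto
  also have "\<dots> = (real m * \<theta>)\<^sup>2" by (simp add: power2_eq_square)
  finally have distance: "(\<Sum>a<m. \<Sum>b<m. (cmod ((if a = b then 1 else 0) - P (\<pi> a) b))\<^sup>2)
    \<le> (real m * \<theta>)\<^sup>2" .

  \<comment> \<open>compare the weights entry by entry, keeping the linear part over \<open>J\<close> as a separate term\<close>
  have "r\<^sup>2 \<le> (\<Sum>j\<in>K. \<Sum>k<m. C * (2 * ((w j - \<sigma>)\<^sup>2 * (cmod (P j k))\<^sup>2 +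
        (w j + \<sigma>)\<^sup>2 * (cmod (N j k))\<^sup>2)) +
      (if j \<in> J then 2 * ((h j - h (\<pi> k))\<^sup>2 * (cmod (P j k))\<^sup>2) else 0))"
    unfolding r(2)
  proof (intro sum_mono)
    fix j k assume j: "j \<in> K" and k: "k \<in> {..<m}"
    define x y where "x = (cmod (P j k))\<^sup>2" and "y = (cmod (N j k))\<^sup>2"
    have xy: "0 \<le> x" "0 \<le> y" by (auto simp: x_def y_def)
    have C: "s + s * (\<alpha> / \<delta>)\<^sup>2 \<le> C * s" "s + s * (\<beta> / \<sigma>)\<^sup>2 \<le> C * s" "s \<le> C * s"
      if "0 \<le> s" for s
      using that by (auto simp: C_def algebra_simps)
    show "2 * (((h j - h (\<pi> k))\<^sup>2 + (w j - \<sigma>)\<^sup>2) * (cmod (P j k))\<^sup>2 +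
           ((h j - h (\<pi> k))\<^sup>2 + (w j + \<sigma>)\<^sup>2) * (cmod (N j k))\<^sup>2)
      \<le> C * (2 * ((w j - \<sigma>)\<^sup>2 * (cmod (P j k))\<^sup>2 + (w j + \<sigma>)\<^sup>2 * (cmod (N j k))\<^sup>2)) +
        (if j \<in> J then 2 * ((h j - h (\<pi> k))\<^sup>2 * (cmod (P j k))\<^sup>2) else 0)"
      unfolding x_def[symmetric] y_def[symmetric]
    proof (cases "j \<in> J")
      case True
      have "(h j - h (\<pi> k))\<^sup>2 \<le> \<beta>\<^sup>2"
        using \<beta>(2)[OF True \<pi>J] k by (simp add: abs_le_square_iff[symmetric] \<beta>(1))
      also have "\<beta>\<^sup>2 = \<sigma>\<^sup>2 * (\<beta> / \<sigma>)\<^sup>2" using \<sigma> by (simp add: power_divide)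
      also have "\<dots> \<le> (w j + \<sigma>)\<^sup>2 * (\<beta> / \<sigma>)\<^sup>2"
        using w(1)[OF j] \<sigma> by (intro mult_right_mono power_mono) auto
      finally have "(h j - h (\<pi> k))\<^sup>2 + (w j + \<sigma>)\<^sup>2 \<le> C * (w j + \<sigma>)\<^sup>2"
        using C(2)[of "(w j + \<sigma>)\<^sup>2"] by simp
      then have "((h j - h (\<pi> k))\<^sup>2 + (w j + \<sigma>)\<^sup>2) * y \<le> C * (w j + \<sigma>)\<^sup>2 * y"
        using xy by (intro mult_right_mono)
      moreover have "(w j - \<sigma>)\<^sup>2 * x \<le> C * ((w j - \<sigma>)\<^sup>2 * x)"
        using xy by (intro C(3)) auto
      ultimately show "2 * (((h j - h (\<pi> k))\<^sup>2 + (w j - \<sigma>)\<^sup>2) * x + ((h j - h (\<pi> k))\<^sup>2 + (w j + \<sigma>)\<^sup>2) * y)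
        \<le> C * (2 * ((w j - \<sigma>)\<^sup>2 * x + (w j + \<sigma>)\<^sup>2 * y)) +
          (if j \<in> J then 2 * ((h j - h (\<pi> k))\<^sup>2 * x) else 0)"
        using True by (simp add: algebra_simps)
    next
      case False
      then have i: "j \<in> I" using j I by simp
      have "(h j - h (\<pi> k))\<^sup>2 \<le> \<alpha>\<^sup>2"
        using \<alpha>(2)[OF i \<pi>J] k by (simp add: abs_le_square_iff[symmetric] \<alpha>(1))
      also have "\<alpha>\<^sup>2 = \<delta>\<^sup>2 * (\<alpha> / \<delta>)\<^sup>2" using \<delta>(1) by (simp add: power_divide)
      also have "\<dots> \<le> (w j - \<sigma>)\<^sup>2 * (\<alpha> / \<delta>)\<^sup>2"
        using \<delta>(1) \<delta>(2)[OF i] by (intro mult_right_mono) (auto simp: abs_le_square_iff[symmetric])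
      finally have 1: "(h j - h (\<pi> k))\<^sup>2 \<le> (w j - \<sigma>)\<^sup>2 * (\<alpha> / \<delta>)\<^sup>2" .
      also have "\<dots> \<le> (w j + \<sigma>)\<^sup>2 * (\<alpha> / \<delta>)\<^sup>2"
        using w(1)[OF j] \<sigma> by (intro mult_right_mono) (auto simp: abs_le_square_iff[symmetric])
      finally have "(h j - h (\<pi> k))\<^sup>2 + (w j + \<sigma>)\<^sup>2 \<le> C * (w j + \<sigma>)\<^sup>2"
        using C(1)[of "(w j + \<sigma>)\<^sup>2"] by simp
      then have "((h j - h (\<pi> k))\<^sup>2 + (w j + \<sigma>)\<^sup>2) * y \<le> C * (w j + \<sigma>)\<^sup>2 * y"
        using xy by (intro mult_right_mono)
      moreover have "(h j - h (\<pi> k))\<^sup>2 + (w j - \<sigma>)\<^sup>2 \<le> C * (w j - \<sigma>)\<^sup>2"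
        using 1 C(1)[of "(w j - \<sigma>)\<^sup>2"] by simp
      then have "((h j - h (\<pi> k))\<^sup>2 + (w j - \<sigma>)\<^sup>2) * x \<le> C * (w j - \<sigma>)\<^sup>2 * x"
        using xy by (intro mult_right_mono)
      ultimately show "2 * (((h j - h (\<pi> k))\<^sup>2 + (w j - \<sigma>)\<^sup>2) * x + ((h j - h (\<pi> k))\<^sup>2 + (w j + \<sigma>)\<^sup>2) * y)
        \<le> C * (2 * ((w j - \<sigma>)\<^sup>2 * x + (w j + \<sigma>)\<^sup>2 * y)) +
          (if j \<in> J then 2 * ((h j - h (\<pi> k))\<^sup>2 * x) else 0)"
        using False by (simp add: algebra_simps)
    qed
  qed
  also have "\<dots> = C * e\<^sup>2 + (\<Sum>j\<in>J. \<Sum>k<m. 2 * ((h j - h (\<pi> k))\<^sup>2 * (cmod (P j k))\<^sup>2))"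
    unfolding e(2) extend sum.distrib sum_distrib_left
    by (intro arg_cong2[where f = "(+)"] refl sum.cong) auto
  also have "(\<Sum>j\<in>J. \<Sum>k<m. 2 * ((h j - h (\<pi> k))\<^sup>2 * (cmod (P j k))\<^sup>2)) =
      (\<Sum>a<m. \<Sum>k<m. 2 * ((h (\<pi> a) - h (\<pi> k))\<^sup>2 * (cmod (P (\<pi> a) k))\<^sup>2))"
    by (rule sum.reindex_bij_betw[OF \<pi>, symmetric])
  \<comment> \<open>subtracting the identity is free, as the weight vanishes on the diagonal\<close>
  also have "\<dots> \<le> (\<Sum>a<m. \<Sum>k<m. 2 * \<beta>\<^sup>2 * (cmod ((if a = k then 1 else 0) - P (\<pi> a) k))\<^sup>2)"
  proof (intro sum_mono)
    fix a k assume ak: "a \<in> {..<m}" "k \<in> {..<m}"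
    have "(h (\<pi> a) - h (\<pi> k))\<^sup>2 \<le> \<beta>\<^sup>2"
      using \<beta>(2)[OF \<pi>J \<pi>J] ak by (simp add: abs_le_square_iff[symmetric] \<beta>(1))
    then show "2 * ((h (\<pi> a) - h (\<pi> k))\<^sup>2 * (cmod (P (\<pi> a) k))\<^sup>2)
      \<le> 2 * \<beta>\<^sup>2 * (cmod ((if a = k then 1 else 0) - P (\<pi> a) k))\<^sup>2"
      by (cases "a = k") (auto intro: mult_right_mono)
  qed
  also have "\<dots> = 2 * \<beta>\<^sup>2 * (\<Sum>a<m. \<Sum>k<m. (cmod ((if a = k then 1 else 0) - P (\<pi> a) k))\<^sup>2)"
    by (simp add: sum_distrib_left)
  also have "\<dots> \<le> 2 * \<beta>\<^sup>2 * (real m * \<theta>)\<^sup>2"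
    using distance by (intro mult_left_mono) auto
  finally have r_sq: "r\<^sup>2 \<le> C * e\<^sup>2 + 2 * \<beta>\<^sup>2 * (real m * \<theta>)\<^sup>2" by simp
  define c where "c = 1 + \<alpha> / \<delta> + \<beta> / \<sigma>"
  have nonneg: "0 \<le> \<alpha> / \<delta>" "0 \<le> \<beta> / \<sigma>" using \<alpha>(1) \<beta>(1) \<delta>(1) \<sigma> by auto
  have "1 + x\<^sup>2 + y\<^sup>2 \<le> (1 + x + y)\<^sup>2" if "0 \<le> x" "0 \<le> y" for x y :: real
    using that mult_nonneg_nonneg[OF that] by (simp add: power2_eq_square algebra_simps)
  from this[OF nonneg] have "C \<le> c\<^sup>2" by (simp add: C_def c_def)
  then have "C * e\<^sup>2 \<le> (e * c)\<^sup>2" by (simp add: power_mult_distrib mult.commute mult_right_mono)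
  moreover have "2 * \<beta>\<^sup>2 * (real m * \<theta>)\<^sup>2 \<le> (2 * \<beta> * real m * \<theta>)\<^sup>2"
    by (simp add: power_mult_distrib)
  moreover have "0 \<le> 2 * (e * c) * (2 * \<beta> * real m * \<theta>)"
    using nonneg e(1) \<beta>(1) \<theta>_nonneg by (simp add: c_def)
  ultimately have "r\<^sup>2 \<le> (e * c + 2 * \<beta> * real m * \<theta>)\<^sup>2"
    using r_sq unfolding power2_sum by linarith
  then have "r \<le> e * c + 2 * \<beta> * real m * \<theta>"
    by (rule power2_le_imp_le) (use nonneg e(1) \<beta>(1) \<theta>_nonneg in \<open>simp add: c_def\<close>)
  also have "2 * \<beta> * real m * \<theta> \<le> \<beta> * real m * e\<^sup>2 / \<kappa>"
  proof -
    have "2 * \<theta> \<le> e\<^sup>2 / \<kappa>" using \<theta>_le \<kappa>(1) by (simp add: field_simps)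
    then have "\<beta> * real m * (2 * \<theta>) \<le> \<beta> * real m * (e\<^sup>2 / \<kappa>)"
      using \<beta>(1) by (intro mult_left_mono) auto
    then show ?thesis by (simp add: algebra_simps)
  qed
  finally show ?thesis by (simp add: c_def)
qed

section \<open>The bound for the minimal residual\<close>

text \<open>The diagonal of \<open>D\<close> lists the real parts in an unspecified order, and possibly with repetitions; \<open>\<pi>\<close> fixes a
matching of the columns of \<open>D\<close> with \<open>J\<close>.\<close>

lemma diagonal_enumeration:
  fixes f :: "nat \<Rightarrow> 'a"
  assumes D: "D \<in> carrier_mat m m" and J: "finite J" "m = card J"
    and diag: "mset (diag_mat D) = image_mset f (mset_set J)"
  obtains \<pi> where "bij_betw \<pi> {..<m} J" "\<And>k. k < m \<Longrightarrow> D $$ (k, k) = f (\<pi> k)"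
proof -
  define xs where "xs = sorted_list_of_set J"
  have xs: "distinct xs" "set xs = J" "length xs = m"
    using J by (auto simp: xs_def)
  have "mset (diag_mat D) = mset (map f xs)"
    using diag mset_set_set[OF xs(1)] xs(2) by simp
  then obtain \<rho> where \<rho>: "bij_betw \<rho> {..<m} {..<m}"
    and eq: "\<forall>i<m. diag_mat D ! i = map f xs ! \<rho> i"
    using permutation_Ex_bij[of "diag_mat D" "map f xs"] D xs(3) by (auto simp: diag_mat_def)
  show ?thesis
  proof
    have "bij_betw (nth xs) {..<m} J"
      by (rule bij_betw_nth) (use xs in auto)
    then show "bij_betw (nth xs \<circ> \<rho>) {..<m} J"
      by (rule bij_betw_trans[OF \<rho>])
    show "D $$ (k, k) = f ((nth xs \<circ> \<rho>) k)" if "k < m" for k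
    proof -
      have "\<rho> k < m" using \<rho> that by (auto simp: bij_betw_def)
      then show ?thesis using eq that D xs(3) by (auto simp: diag_mat_def)
    qed
  qed
qed

theorem theoremA1:
  fixes p m :: nat and A Q S :: "real mat" and l t :: "nat \<Rightarrow> real"
    and J I :: "nat set" and \<sigma> \<tau> :: real
  assumes A: "A \<in> carrier_mat (2 * p) (2 * p)" "normal_real_mat A"
    and eigenvalues: "char_poly (map_mat complex_of_real A) =
      (\<Prod>j\<in>{1..p}. [:- (of_real (l j) * cis (t j)), 1:] * [:- (of_real (l j) * cis (- t j)), 1:])"
    and l: "\<And>j. j \<in> {1..p} \<Longrightarrow> l j > 0"
    and t: "\<And>j. j \<in> {1..p} \<Longrightarrow> 0 < t j \<and> t j < pi"
    and rsd: "real_schur_decomposition p A l t Q S"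
    and J: "J \<subseteq> {1..p}" "J \<noteq> {}" "\<And>j. j \<in> J \<Longrightarrow> l j * sin (t j) = \<sigma>"
    and I: "I = {1..p} - J" "\<And>i. i \<in> I \<Longrightarrow> l i * sin (t i) \<noteq> \<sigma>"
    and m: "m = card J"
    and \<tau>: "\<tau> \<ge> 1"
  shows "\<exists>g :: real \<Rightarrow> real. g \<in> o[at_right 0](\<lambda>\<epsilon>. \<epsilon>) \<and>
    (\<forall>\<epsilon>>0. \<forall>D V E.
      D \<in> carrier_mat m m \<and> diagonal_mat D \<and>
      mset (diag_mat D) = image_mset (\<lambda>j. l j * cos (t j)) (mset_set J) \<and>
      V \<in> stiefel (2 * p) (2 * m) \<and>
      skew_part A * V - V * (\<sigma> \<cdot>\<^sub>m four_block_mat (0\<^sub>m m m) (- 1\<^sub>m m) (1\<^sub>m m) (0\<^sub>m m m)) = E \<and>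
      frobenius_norm E \<le> \<tau> * \<epsilon> * frobenius_norm A
      \<longrightarrow>
      (\<exists>R. is_arg_min
            (\<lambda>R. frobenius_norm (A * (V * R) -
               (V * R) * four_block_mat D (- (\<sigma> \<cdot>\<^sub>m 1\<^sub>m m)) (\<sigma> \<cdot>\<^sub>m 1\<^sub>m m) D))
            (\<lambda>R. R \<in> ortho_symplectic m) R \<and>
          frobenius_norm (A * (V * R) -
               (V * R) * four_block_mat D (- (\<sigma> \<cdot>\<^sub>m 1\<^sub>m m)) (\<sigma> \<cdot>\<^sub>m 1\<^sub>m m) D)
          \<le> \<tau> * \<epsilon> * frobenius_norm A *
              (1 + (if I = {} then 0
                    else Max ((\<lambda>(i, j). \<bar>l i * cos (t i) - l j * cos (t j)\<bar>) ` (I \<times> J)) /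
                         Min ((\<lambda>i. \<bar>l i * sin (t i) - \<sigma>\<bar>) ` I))
                 + Max ((\<lambda>(j1, j2). \<bar>l j1 * cos (t j1) - l j2 * cos (t j2)\<bar>) ` (J \<times> J)) / \<sigma>)
            + g \<epsilon>))"
proof -
  define h w where "h = (\<lambda>j. l j * cos (t j))" and "w = (\<lambda>j. l j * sin (t j))"
  have hw: "l j * cos (t j) = h j" "l j * sin (t j) = w j" for j by (simp_all add: h_def w_def)
  have fin: "finite J" "finite I" using J(1) I(1) finite_subset by auto
  have w_pos: "0 < w j" if "j \<in> {1..p}" for j
    using l[OF that] t[OF that] by (simp add: w_def sin_gt_zero)
  have wJ: "w j = \<sigma>" if "j \<in> J" for j using J(3)[OF that] by (simp add: w_def)
  have \<sigma>: "0 < \<sigma>" using J w_pos wJ by force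

  \<comment> \<open>for empty \<open>I\<close> the values \<open>\<alpha> = 0\<close> and \<open>\<delta> = 1\<close> make the first fraction vanish\<close>
  define \<alpha> where "\<alpha> = (if I = {} then 0 else Max ((\<lambda>(i, j). \<bar>h i - h j\<bar>) ` (I \<times> J)))"
  define \<delta> where "\<delta> = (if I = {} then 1 else Min ((\<lambda>i. \<bar>w i - \<sigma>\<bar>) ` I))"
  define \<beta> where "\<beta> = Max ((\<lambda>(j1, j2). \<bar>h j1 - h j2\<bar>) ` (J \<times> J))"
  define \<kappa> where "\<kappa> = min (\<sigma>\<^sup>2) (\<delta>\<^sup>2)"
  have \<alpha>: "\<bar>h i - h j\<bar> \<le> \<alpha>" if "i \<in> I" "j \<in> J" for i j
    using that fin by (auto simp: \<alpha>_def intro!: Max_ge)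
  have \<alpha>_nonneg: "0 \<le> \<alpha>"
  proof (cases "I = {}")
    case False
    then obtain i j where "i \<in> I" "j \<in> J" using J(2) by auto
    from \<alpha>[OF this] show ?thesis by linarith
  qed (simp add: \<alpha>_def)
  have \<beta>: "\<bar>h i - h j\<bar> \<le> \<beta>" if "i \<in> J" "j \<in> J" for i j
    using that fin by (auto simp: \<beta>_def intro!: Max_ge)
  have \<beta>_nonneg: "0 \<le> \<beta>" using J(2) \<beta> by fastforce
  have \<delta>: "\<delta> \<le> \<bar>w i - \<sigma>\<bar>" if "i \<in> I" for i
    using that fin by (auto simp: \<delta>_def)
  have \<delta>_pos: "0 < \<delta>"
  proof (cases "I = {}")
    case False
    then show ?thesis using fin I(2) by (simp add: \<delta>_def w_def)
  qed (simp add: \<delta>_def)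
  have \<kappa>: "0 < \<kappa>" "\<kappa> \<le> \<sigma>\<^sup>2" using \<sigma> \<delta>_pos by (auto simp: \<kappa>_def)
  have \<kappa>I: "\<kappa> \<le> (w i - \<sigma>)\<^sup>2" if "i \<in> I" for i
  proof -
    have "\<delta>\<^sup>2 \<le> (w i - \<sigma>)\<^sup>2"
      using \<delta>[OF that] \<delta>_pos by (simp add: abs_le_square_iff[symmetric])
    then show ?thesis by (simp add: \<kappa>_def)
  qed

  define C where "C = \<beta> * real m * (\<tau> * frobenius_norm A)\<^sup>2 / \<kappa>"
  define g where "g = (\<lambda>\<epsilon> :: real. C * \<epsilon>\<^sup>2)"
  have g_small: "g \<in> o[at_right 0](\<lambda>\<epsilon>. \<epsilon>)"
  proof (rule smalloI_tendsto)
    have "((\<lambda>\<epsilon>. C * \<epsilon>) \<longlongrightarrow> C * 0) (at_right 0)" by (intro tendsto_intros)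
    moreover have "\<forall>\<^sub>F \<epsilon> in at_right 0. g \<epsilon> / \<epsilon> = C * \<epsilon>"
      using eventually_at_right_less[of 0]
      by eventually_elim (simp add: g_def power2_eq_square)
    ultimately show "((\<lambda>\<epsilon>. g \<epsilon> / \<epsilon>) \<longlongrightarrow> 0) (at_right 0)"
      by (simp add: tendsto_cong)
    show "\<forall>\<^sub>F \<epsilon> in at_right 0. (\<epsilon> :: real) \<noteq> 0"
      using eventually_at_right_less[of 0] by eventually_elim simp
  qed

  have Q: "Q \<in> carrier_mat (2 * p) (2 * p)" "transpose_mat Q * Q = 1\<^sub>m (2 * p)"
      "Q * transpose_mat Q = 1\<^sub>m (2 * p)"
    and S_eq: "S = diag_block_mat (map (\<lambda>j. schur_block (l j) (t j)) [1..<p + 1])"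
    and A_eq: "A = Q * S * transpose_mat Q"
    using rsd by (auto simp: real_schur_decomposition_def orthogonal_group_def)
  note S = schur_form_entries(1)[OF S_eq]
  note S_entries = schur_form_entries(2)[OF S_eq, unfolded hw]
  have skewS: "skew_part S \<in> carrier_mat (2 * p) (2 * p)" using S by (rule skew_part_carrier)
  have skewS_entries: "skew_part S $$ (2 * i - 2, 2 * j - 2) = (if i = j then 0 else 0) \<and>
      skew_part S $$ (2 * i - 2, 2 * j - 1) = (if i = j then - w i else 0) \<and>
      skew_part S $$ (2 * i - 1, 2 * j - 2) = (if i = j then w i else 0) \<and>
      skew_part S $$ (2 * i - 1, 2 * j - 1) = (if i = j then 0 else 0)"
    if ij: "i \<in> {1..p}" "j \<in> {1..p}" for i j
  proof -
    have lt: "2 * i - 2 < 2 * p" "2 * i - 1 < 2 * p" "2 * j - 2 < 2 * p" "2 * j - 1 < 2 * p"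
      using ij by auto
    show ?thesis
      using S_entries[OF ij] S_entries[OF ij(2,1)]
      by (auto simp: skew_part_entry[OF S] lt simp del: One_nat_def)
  qed

  have bound: "\<exists>R. is_arg_min (\<lambda>R. frobenius_norm (A * (V * R) - (V * R) * B)) (\<lambda>R. R \<in> ortho_symplectic m) R \<and>
      frobenius_norm (A * (V * R) - (V * R) * B)
        \<le> \<tau> * \<epsilon> * frobenius_norm A * (1 + \<alpha> / \<delta> + \<beta> / \<sigma>) + g \<epsilon>"
    if \<epsilon>: "0 < \<epsilon>" and D: "D \<in> carrier_mat m m" "diagonal_mat D"
      "mset (diag_mat D) = image_mset h (mset_set J)"
      and V: "V \<in> stiefel (2 * p) (2 * m)"
      and B: "B = four_block_mat D (- (\<sigma> \<cdot>\<^sub>m 1\<^sub>m m)) (\<sigma> \<cdot>\<^sub>m 1\<^sub>m m) D"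
      and K: "K = \<sigma> \<cdot>\<^sub>m four_block_mat (0\<^sub>m m m) (- 1\<^sub>m m) (1\<^sub>m m) (0\<^sub>m m m)"
      and E: "frobenius_norm (skew_part A * V - V * K) \<le> \<tau> * \<epsilon> * frobenius_norm A"
    for \<epsilon> D V B K
  proof -
    let ?n = "2 * p" and ?k = "2 * m"
    have dimV: "V \<in> carrier_mat ?n ?k" and orthV: "transpose_mat V * V = 1\<^sub>m ?k"
      using V by (auto simp: stiefel_def)
    have dimB: "B \<in> carrier_mat ?k ?k" using D(1) by (auto simp: B mult_2)
    have dimK: "K \<in> carrier_mat ?k ?k" by (auto simp: K mult_2)
    have Q': "transpose_mat Q \<in> carrier_mat ?n ?n" using Q by simp
    obtain \<pi> where \<pi>: "bij_betw \<pi> {..<m} J" and D_eq: "\<And>k. k < m \<Longrightarrow> D $$ (k, k) = h (\<pi> k)"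
      using diagonal_enumeration[OF D(1) fin(1) m D(3)] by blast
    have \<pi>_range: "\<pi> k \<in> {1..p}" if "k < m" for k
      using \<pi> that J(1) by (auto simp: bij_betw_def)
    define W0 where "W0 = transpose_mat Q * V"
    have W0: "W0 \<in> carrier_mat ?n ?k" using Q' dimV by (simp add: W0_def)
    \<comment> \<open>the rotation \<open>R\<close> used for the estimate maximises this trace, not minus the residual\<close>
    define trace where "trace = (\<lambda>R. \<Sum>k<m. (W0 * R) $$ (2 * \<pi> k - 2, k) + (W0 * R) $$ (2 * \<pi> k - 1, k + m))"
    have "continuous_on UNIV (\<lambda>f. - trace (mat ?k ?k f))"
      unfolding trace_def using \<pi>_range
      by (intro continuous_intros continuous_mult_entry[OF W0]) force+
    then obtain R where R: "R \<in> ortho_symplectic m"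
      and R_max: "\<And>G. G \<in> ortho_symplectic m \<Longrightarrow> trace G \<le> trace R"
      using ortho_symplectic_attains_inf[where m = m and F = "\<lambda>R. - trace R"] by auto
    have dimR: "R \<in> carrier_mat ?k ?k" and orthR: "transpose_mat R * R = 1\<^sub>m ?k" "R * transpose_mat R = 1\<^sub>m ?k"
      using R by (auto simp: ortho_symplectic_iff orthogonal_group_def)
    define W where "W = W0 * R"
    have W: "W \<in> carrier_mat ?n ?k" using W0 dimR by (simp add: W_def)
    have W_eq: "W = transpose_mat Q * (V * R)"
      unfolding W_def W0_def by (rule assoc_mult_mat[OF Q' dimV dimR])
    have dimVR: "V * R \<in> carrier_mat ?n ?k" using dimV dimR by simp
    have "W \<in> stiefel ?n ?k"
    proof -
      have 1: "transpose_mat (V * R) * (V * R) = transpose_mat R * ((transpose_mat V * V) * R)"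
        using dimV dimR by (simp add: transpose_mult[of _ ?n ?k _ ?k]
            assoc_mult_mat[of _ ?k ?k _ ?n _ ?k] assoc_mult_mat[of _ ?k ?n _ ?k _ ?k])
      have "transpose_mat W * W = transpose_mat (V * R) * ((Q * transpose_mat Q) * (V * R))"
        unfolding W_eq using Q(1) Q' dimVR by (simp add: transpose_mult[of _ ?n ?n _ ?k]
            assoc_mult_mat[of _ ?k ?n _ ?n _ ?k] assoc_mult_mat[of _ ?n ?n _ ?n _ ?k] del: assoc_mult_mat)
      also have "\<dots> = 1\<^sub>m ?k" using Q(3) dimR orthV orthR 1 by (simp add: left_mult_one_mat[OF dimVR] left_mult_one_mat[OF dimR])
      finally show ?thesis using W by (simp add: stiefel_def)
    qed
    note gram = stiefel_parts_gram[OF this]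
    have psd: "Im (\<Sum>a<m. \<Sum>b<m. cnj (v a) * linear_part m W (\<pi> a) b * v b) = 0 \<and>
        0 \<le> Re (\<Sum>a<m. \<Sum>b<m. cnj (v a) * linear_part m W (\<pi> a) b * v b)" for v
    proof (rule maximal_trace_linear_part[OF W \<pi>_range])
      fix G assume G: "G \<in> ortho_symplectic m"
      then have "G \<in> carrier_mat ?k ?k" by (auto simp: ortho_symplectic_iff orthogonal_group_def)
      then have "W * G = W0 * (R * G)"
        unfolding W_def by (rule assoc_mult_mat[OF W0 dimR])
      then show "(\<Sum>k<m. (W * G) $$ (2 * \<pi> k - 2, k) + (W * G) $$ (2 * \<pi> k - 1, k + m))
          \<le> (\<Sum>k<m. W $$ (2 * \<pi> k - 2, k) + W $$ (2 * \<pi> k - 1, k + m))"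
        using R_max[OF ortho_symplectic_mult[OF R G]] unfolding trace_def W_def by simp
    qed

    define e where "e = frobenius_norm (skew_part A * V - V * K)"
    define r where "r = frobenius_norm (A * (V * R) - (V * R) * B)"
    have skewA: "skew_part A \<in> carrier_mat ?n ?n" using A(1) by (rule skew_part_carrier)
    have coords: "frobenius_norm (transpose_mat Q * X) = frobenius_norm X"
      if "X \<in> carrier_mat ?n ?k" for X
      by (rule frobenius_norm_mult_left[OF that]) (use Q in auto)

    have dim_residual: "X * Z - Z * Y \<in> carrier_mat ?n ?k"
      if "Z \<in> carrier_mat ?n ?k" "Y \<in> carrier_mat ?k ?k" for X Y Z :: "real mat"
      using that by (intro minus_carrier_mat mult_carrier_mat)

    have "transpose_mat Q * A = S * transpose_mat Q"
    proof -
      have "transpose_mat Q * A = (transpose_mat Q * Q) * (S * transpose_mat Q)"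
        unfolding A_eq using Q(1) Q' S by (simp add: assoc_mult_mat[of _ ?n ?n _ ?n _ ?n])
      then show ?thesis using Q(2) Q' S by simp
    qed
    then have "transpose_mat Q * (A * (V * R) - (V * R) * B) = S * W - W * B"
      unfolding W_eq by (rule intertwined_residual[OF A(1) S Q' dimVR dimB])
    then have r_eq: "r = frobenius_norm (S * W - W * B)"
      unfolding r_def using coords[OF dim_residual[OF dimVR dimB, of A]] by simp
    have r_sq: "r\<^sup>2 = (\<Sum>j\<in>{1..p}. \<Sum>k<m.
      2 * (((h j - h (\<pi> k))\<^sup>2 + (w j - \<sigma>)\<^sup>2) * (cmod (linear_part m W j k))\<^sup>2 +
           ((h j - h (\<pi> k))\<^sup>2 + (w j + \<sigma>)\<^sup>2) * (cmod (antilinear_part m W j k))\<^sup>2))"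
      unfolding r_eq B
      by (subst sylvester_norm[where h = h and w = w, OF S S_entries W D(1,2)]) (simp_all add: D_eq)

    \<comment> \<open>\<open>E R\<close> is the skew residual of the rotated basis \<open>V R\<close>, as \<open>R\<close> commutes with \<open>K\<close>\<close>
    have commute: "K * R = R * K" unfolding K by (rule ortho_symplectic_commute[OF R])
    have "(skew_part A * V - V * K) * R = skew_part A * (V * R) - (V * R) * K"
    proof -
      have "(skew_part A * V - V * K) * R = skew_part A * V * R - V * K * R"
        by (rule minus_mult_distrib_mat) (use skewA dimV dimK dimR in auto)
      also have "V * K * R = V * R * K"
        using assoc_mult_mat[OF dimV dimK dimR] assoc_mult_mat[OF dimV dimR dimK] commute by simp
      finally show ?thesis using assoc_mult_mat[OF skewA dimV dimR] by simp
    qed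
    then have "e = frobenius_norm (skew_part A * (V * R) - (V * R) * K)"
      unfolding e_def
      using frobenius_norm_mult_right[OF dim_residual[OF dimV dimK, of "skew_part A"] dimR orthR(2)] by simp
    also have "\<dots> = frobenius_norm (transpose_mat Q * (skew_part A * (V * R) - (V * R) * K))"
      using coords[OF dim_residual[OF dimVR dimK, of "skew_part A"]] by simp
    also have "transpose_mat Q * (skew_part A * (V * R) - (V * R) * K) = skew_part S * W - W * K"
      unfolding W_eq
      by (rule intertwined_residual[OF skewA skewS Q' dimVR dimK])
        (rule skew_part_similarity[OF Q(1,2) S, folded A_eq])
    also have "K = four_block_mat (0\<^sub>m m m) (- (\<sigma> \<cdot>\<^sub>m 1\<^sub>m m)) (\<sigma> \<cdot>\<^sub>m 1\<^sub>m m) (0\<^sub>m m m)"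
      unfolding K by (rule eq_matI) auto
    finally have e_eq: "e = frobenius_norm (skew_part S * W -
      W * four_block_mat (0\<^sub>m m m) (- (\<sigma> \<cdot>\<^sub>m 1\<^sub>m m)) (\<sigma> \<cdot>\<^sub>m 1\<^sub>m m) (0\<^sub>m m m))" .
    have e_sq: "e\<^sup>2 = (\<Sum>j\<in>{1..p}. \<Sum>k<m. 2 * ((w j - \<sigma>)\<^sup>2 * (cmod (linear_part m W j k))\<^sup>2 +
        (w j + \<sigma>)\<^sup>2 * (cmod (antilinear_part m W j k))\<^sup>2))"
      unfolding e_eq
      by (subst sylvester_norm[where h = "\<lambda>_. 0" and w = w, OF skewS skewS_entries W])
        (auto simp: diagonal_mat_def)
    have e_nonneg: "0 \<le> e" and r_nonneg: "0 \<le> r"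
      by (simp_all add: e_def r_def frobenius_norm_nonneg)

    have "r \<le> e * (1 + \<alpha> / \<delta> + \<beta> / \<sigma>) + \<beta> * real m * e\<^sup>2 / \<kappa>"
      by (rule aligned_residual_bound[where h = h and w = w, OF \<pi> _ J(1) I(1) gram psd w_pos wJ \<sigma> \<kappa> \<kappa>I
            \<delta>_pos \<delta> \<alpha>_nonneg \<alpha> \<beta>_nonneg \<beta> e_nonneg e_sq r_nonneg r_sq]) simp
    also have "\<dots> \<le> \<tau> * \<epsilon> * frobenius_norm A * (1 + \<alpha> / \<delta> + \<beta> / \<sigma>) + g \<epsilon>"
    proof (rule add_mono)
      show "e * (1 + \<alpha> / \<delta> + \<beta> / \<sigma>) \<le> \<tau> * \<epsilon> * frobenius_norm A * (1 + \<alpha> / \<delta> + \<beta> / \<sigma>)"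
        using E \<alpha>_nonneg \<beta>_nonneg \<delta>_pos \<sigma> unfolding e_def by (intro mult_right_mono) auto
      have "e\<^sup>2 \<le> (\<tau> * \<epsilon> * frobenius_norm A)\<^sup>2"
        using E e_nonneg unfolding e_def by (intro power_mono) auto
      then have "\<beta> * real m * e\<^sup>2 / \<kappa> \<le> \<beta> * real m * (\<tau> * \<epsilon> * frobenius_norm A)\<^sup>2 / \<kappa>"
        using \<beta>_nonneg \<kappa>(1) by (intro divide_right_mono mult_left_mono) auto
      also have "\<dots> = g \<epsilon>" by (simp add: g_def C_def power_mult_distrib)
      finally show "\<beta> * real m * e\<^sup>2 / \<kappa> \<le> g \<epsilon>" .
    qed
    finally have R_bound: "frobenius_norm (A * (V * R) - (V * R) * B)
        \<le> \<tau> * \<epsilon> * frobenius_norm A * (1 + \<alpha> / \<delta> + \<beta> / \<sigma>) + g \<epsilon>"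
      unfolding r_def .
    obtain R0 where R0: "R0 \<in> ortho_symplectic m"
      and R0_min: "\<And>G. G \<in> ortho_symplectic m \<Longrightarrow>
        frobenius_norm (A * (V * R0) - (V * R0) * B) \<le> frobenius_norm (A * (V * G) - (V * G) * B)"
      using ortho_symplectic_attains_inf[OF continuous_residual_norm[OF A(1) dimV dimB]] by auto
    show ?thesis
    proof (intro exI[of _ R0] conjI)
      show "is_arg_min (\<lambda>R. frobenius_norm (A * (V * R) - (V * R) * B)) (\<lambda>R. R \<in> ortho_symplectic m) R0"
        using R0 R0_min by (auto simp: is_arg_min_def not_less)
      show "frobenius_norm (A * (V * R0) - (V * R0) * B)
        \<le> \<tau> * \<epsilon> * frobenius_norm A * (1 + \<alpha> / \<delta> + \<beta> / \<sigma>) + g \<epsilon>"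
        using R0_min[OF R] R_bound by linarith
    qed
  qed

  have \<alpha>\<delta>: "(if I = {} then 0 else Max ((\<lambda>(i, j). \<bar>h i - h j\<bar>) ` (I \<times> J)) / Min ((\<lambda>i. \<bar>w i - \<sigma>\<bar>) ` I))
      = \<alpha> / \<delta>"
    by (simp add: \<alpha>_def \<delta>_def)
  show ?thesis
    unfolding hw \<alpha>\<delta> \<beta>_def[symmetric]
  proof (intro exI[of _ g] conjI allI impI g_small, elim conjE)
    fix \<epsilon> :: real and D V E :: "real mat"
    assume "0 < \<epsilon>" "D \<in> carrier_mat m m" "diagonal_mat D"
      "mset (diag_mat D) = image_mset h (mset_set J)" "V \<in> stiefel (2 * p) (2 * m)"
      "skew_part A * V - V * (\<sigma> \<cdot>\<^sub>m four_block_mat (0\<^sub>m m m) (- 1\<^sub>m m) (1\<^sub>m m) (0\<^sub>m m m)) = E"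
      "frobenius_norm E \<le> \<tau> * \<epsilon> * frobenius_norm A"
    then show "\<exists>R. is_arg_min
            (\<lambda>R. frobenius_norm (A * (V * R) -
               (V * R) * four_block_mat D (- (\<sigma> \<cdot>\<^sub>m 1\<^sub>m m)) (\<sigma> \<cdot>\<^sub>m 1\<^sub>m m) D))
            (\<lambda>R. R \<in> ortho_symplectic m) R \<and>
          frobenius_norm (A * (V * R) -
               (V * R) * four_block_mat D (- (\<sigma> \<cdot>\<^sub>m 1\<^sub>m m)) (\<sigma> \<cdot>\<^sub>m 1\<^sub>m m) D)
          \<le> \<tau> * \<epsilon> * frobenius_norm A * (1 + \<alpha> / \<delta> + \<beta> / \<sigma>) + g \<epsilon>"
      using bound[OF _ _ _ _ _ refl refl] by blast
  qed
qed

end
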